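(* Let $\mathbb{F}$ be a finite field. Given an instance of VEST over $\mathbb{F}$ in which all rows of each matrix $T_1,\dots,T_m$ except the first $p$ rows are zero, and given $k\in\mathbb{N}$, computing $M_k$ is fixed-parameter tractable when parameterized by $|\mathbb{F}|$ and $p$.
   Context: An instance of VEST over a field $\mathbb{F}$ consists of positive integers $d,m,h$, a vector $\mathbf{v}\in\mathbb{F}^d$, a list $(T_1,\dots,T_m)$ of $d\times d$ matrices over $\mathbb{F}$, and a matrix $S\in\mathbb{F}^{h\times d}$. For $k\in\mathbb{N}$, $M_k := |\{(i_1,\dots,i_k)\in\{1,\dots,m\}^k : S T_{i_k}\cdots T_{i_1}\mathbf{v}=\mathbf{0}\}|$. Fixed-parameter tractable means computable in time $f(|\mathbb{F}|,p)\cdot n^{c}$ for a computable $f$, constant $c$, and input size $n$.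
   Formalization: The number k is given in unary, so the input size n counts k itself; with k in binary the claim fails, since M_k can equal 2^k (e.g. S = 0, m = 2) and its output alone is exponentially long in the input. *)

theory Defs
  imports "HOL-Algebra.Ring" "HOL-Library.Log_Nat" "Jordan_Normal_Form.Matrix"
begin

section \<open>VEST\<close>

text \<open>
  The ground field is an explicit record in the style of HOL-Algebra and not a type, because one
  algorithm has to work for all finite fields. Vectors and matrices are the containers of
  Jordan-Normal-Form; their built-in products refer to the type class operations on the entries,
  so the product over the given field is defined here.
\<close>

record 'a vest =
  vest_d :: nat
  vest_m :: nat
  vest_h :: nat
  vest_v :: "'a vec"
  vest_T :: "'a mat list"
  vest_S :: "'a mat"

definition vest_instance :: "('a, 'b) ring_scheme \<Rightarrow> 'a vest \<Rightarrow> bool" where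
  "vest_instance F V \<longleftrightarrow>
     0 < vest_d V \<and> 0 < vest_m V \<and> 0 < vest_h V \<and>
     vest_v V \<in> carrier_vec (vest_d V) \<and>
     (\<forall>i<vest_d V. vest_v V $ i \<in> carrier F) \<and>
     length (vest_T V) = vest_m V \<and>
     (\<forall>A\<in>set (vest_T V). A \<in> carrier_mat (vest_d V) (vest_d V) \<and> elements_mat A \<subseteq> carrier F) \<and>
     vest_S V \<in> carrier_mat (vest_h V) (vest_d V) \<and> elements_mat (vest_S V) \<subseteq> carrier F"

definition mult_mat_vec_over :: "('a, 'b) ring_scheme \<Rightarrow> 'a mat \<Rightarrow> 'a vec \<Rightarrow> 'a vec" where
  "mult_mat_vec_over F A w =
     vec (dim_row A) (\<lambda>i. \<Oplus>\<^bsub>F\<^esub>j\<in>{..<dim_col A}. A $$ (i, j) \<otimes>\<^bsub>F\<^esub> w $ j)"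

text \<open>
  Matrices are indexed from 0. The list \<open>[i\<^sub>1, \<dots>, i\<^sub>k]\<close> stands for the product in which the
  matrix with index \<open>i\<^sub>1\<close> is applied to the vector first.
\<close>

definition vest_eval :: "('a, 'b) ring_scheme \<Rightarrow> 'a vest \<Rightarrow> nat list \<Rightarrow> 'a vec" where
  "vest_eval F V is =
     mult_mat_vec_over F (vest_S V)
       (fold (\<lambda>i w. mult_mat_vec_over F (vest_T V ! i) w) is (vest_v V))"

definition vest_M :: "('a, 'b) ring_scheme \<Rightarrow> 'a vest \<Rightarrow> nat \<Rightarrow> nat" where
  "vest_M F V k =
     card {is. length is = k \<and> set is \<subseteq> {..<vest_m V} \<and>
               vest_eval F V is = vec (vest_h V) (\<lambda>_. \<zero>\<^bsub>F\<^esub>)}"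

definition rows_zero_from :: "('a, 'b) ring_scheme \<Rightarrow> nat \<Rightarrow> 'a vest \<Rightarrow> bool" where
  "rows_zero_from F p V \<longleftrightarrow>
     (\<forall>A\<in>set (vest_T V). \<forall>i j. p \<le> i \<longrightarrow> i < vest_d V \<longrightarrow> j < vest_d V \<longrightarrow> A $$ (i, j) = \<zero>\<^bsub>F\<^esub>)"


section \<open>Random access machines\<close>

text \<open>
  The random access machine of Papadimitriou's \<^emph>\<open>Computational Complexity\<close> (Section 2.6), in the
  version with natural numbers and cut-off subtraction that Flum and Grohe use for parameterized
  complexity. The input is a read-only sequence of numbers, register 0 is the accumulator and
  finally holds the output, and all registers are initially 0. Every instruction costs one unit.
  As there is no multiplication, a step increases the maximal bit length of the registers by at
  most one (up to the numbers in the input and the program), so that running times agree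
  with those of Turing machines up to a polynomial.
\<close>

datatype operand = Imm nat | Reg nat | Ind nat

datatype instr =
    READ operand
  | LOAD operand
  | STORE nat
  | STORE_IND nat
  | ADD operand
  | SUB operand
  | HALF
  | JUMP nat
  | JPOS nat
  | JZERO nat

type_synonym ram = "instr list"
type_synonym config = "nat \<times> (nat \<Rightarrow> nat)"

fun operand_val :: "(nat \<Rightarrow> nat) \<Rightarrow> operand \<Rightarrow> nat" where
  "operand_val r (Imm c) = c"
| "operand_val r (Reg j) = r j"
| "operand_val r (Ind j) = r (r j)"

text \<open>Reading beyond the end of the input yields 0.\<close>

fun exec_instr :: "nat list \<Rightarrow> instr \<Rightarrow> config \<Rightarrow> config" where
  "exec_instr xs (READ a) (pc, r) =
     (Suc pc, r(0 := (let i = operand_val r a in if i < length xs then xs ! i else 0)))"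
| "exec_instr xs (LOAD a) (pc, r) = (Suc pc, r(0 := operand_val r a))"
| "exec_instr xs (STORE j) (pc, r) = (Suc pc, r(j := r 0))"
| "exec_instr xs (STORE_IND j) (pc, r) = (Suc pc, r(r j := r 0))"
| "exec_instr xs (ADD a) (pc, r) = (Suc pc, r(0 := r 0 + operand_val r a))"
| "exec_instr xs (SUB a) (pc, r) = (Suc pc, r(0 := r 0 - operand_val r a))"
| "exec_instr xs HALF (pc, r) = (Suc pc, r(0 := r 0 div 2))"
| "exec_instr xs (JUMP l) (pc, r) = (l, r)"
| "exec_instr xs (JPOS l) (pc, r) = (if 0 < r 0 then l else Suc pc, r)"
| "exec_instr xs (JZERO l) (pc, r) = (if r 0 = 0 then l else Suc pc, r)"

definition halted :: "ram \<Rightarrow> config \<Rightarrow> bool" where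
  "halted P c \<longleftrightarrow> length P \<le> fst c"

definition ram_step :: "ram \<Rightarrow> nat list \<Rightarrow> config \<Rightarrow> config" where
  "ram_step P xs c = (if halted P c then c else exec_instr xs (P ! fst c) c)"

text \<open>Halted configurations are fixed points of \<^const>\<open>ram_step\<close>, so \<open>t\<close> is an upper bound.\<close>

definition ram_computes_within :: "ram \<Rightarrow> nat list \<Rightarrow> nat \<Rightarrow> nat \<Rightarrow> bool" where
  "ram_computes_within P xs y t \<longleftrightarrow>
     (let c = (ram_step P xs ^^ t) (0, \<lambda>_. 0) in halted P c \<and> snd c 0 = y)"


section \<open>Fixed-parameter tractability\<close>

definition computable2 :: "(nat \<Rightarrow> nat \<Rightarrow> nat) \<Rightarrow> bool" where
  "computable2 f \<longleftrightarrow> (\<exists>P. \<forall>a b. \<exists>t. ram_computes_within P [a, b] (f a b) t)"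

text \<open>The total number of bits, where the number 0 also takes one bit.\<close>

definition input_size :: "nat list \<Rightarrow> nat" where
  "input_size xs = (\<Sum>x\<leftarrow>xs. max 1 (floorlog 2 x))"

text \<open>
  The function \<open>g\<close> on the instances in \<open>I\<close>, which are presented to the machine through \<open>enc\<close>, is
  fixed-parameter tractable with respect to the pair of parameters \<open>\<kappa>\<^sub>1\<close>, \<open>\<kappa>\<^sub>2\<close>.
\<close>

definition fpt ::
  "'i set \<Rightarrow> ('i \<Rightarrow> nat list) \<Rightarrow> ('i \<Rightarrow> nat) \<Rightarrow> ('i \<Rightarrow> nat) \<Rightarrow> ('i \<Rightarrow> nat) \<Rightarrow> bool" where
  "fpt I enc \<kappa>\<^sub>1 \<kappa>\<^sub>2 g \<longleftrightarrow>
     (\<exists>P f c. computable2 f \<and>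
        (\<forall>x\<in>I. ram_computes_within P (enc x) (g x) (f (\<kappa>\<^sub>1 x) (\<kappa>\<^sub>2 x) * input_size (enc x) ^ c)))"


section \<open>Encoding of instances\<close>

text \<open>
  A finite field with \<open>q\<close> elements is presented on the carrier \<open>{..<q}\<close> by its constants and its
  operation tables. Any labelling of the elements is allowed, so every finite field has such
  a presentation.
\<close>

definition finite_field_presentation :: "nat ring \<Rightarrow> bool" where
  "finite_field_presentation F \<longleftrightarrow> field F \<and> carrier F = {..<card (carrier F)}"

definition encode_field :: "nat ring \<Rightarrow> nat list" where
  "encode_field F =
     (let q = card (carrier F) in
        [q, \<zero>\<^bsub>F\<^esub>, \<one>\<^bsub>F\<^esub>]
        @ [a \<oplus>\<^bsub>F\<^esub> b. a \<leftarrow> [0..<q], b \<leftarrow> [0..<q]]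
        @ [a \<otimes>\<^bsub>F\<^esub> b. a \<leftarrow> [0..<q], b \<leftarrow> [0..<q]])"

definition encode_vest :: "nat vest \<Rightarrow> nat list" where
  "encode_vest V =
     [vest_d V, vest_m V, vest_h V]
     @ list_of_vec (vest_v V)
     @ concat (map (\<lambda>A. concat (mat_to_list A)) (vest_T V))
     @ concat (mat_to_list (vest_S V))"

text \<open>
  The number \<open>k\<close> is written in unary: \<open>M\<^sub>k\<close> can be as large as \<open>m\<^sup>k\<close> and thus have about
  \<open>k log m\<close> bits, which in general is not polynomial in the size of a binary encoding of \<open>k\<close>.
\<close>

definition encode_unary :: "nat \<Rightarrow> nat list" where
  "encode_unary k = replicate k 1 @ [0]"

fun encode_input :: "nat ring \<times> nat \<times> nat vest \<times> nat \<Rightarrow> nat list" where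
  "encode_input (F, p, V, k) = encode_field F @ [p] @ encode_vest V @ encode_unary k"

end

(*
  Counting backwards makes dynamic programming possible: if g_t(w) is the number of index
  sequences of length t that lead from the vector w to the kernel of S, then g_0(w) tells whether
  S w = 0, g_(t+1)(w) is the sum of g_t(T_i w) over all i, and M_k = g_k(v). Each T_i maps into the
  vectors supported on the first min(p, d) coordinates, so that g_t has to be tabulated only for
  these q^min(p, d) vectors and for v, which takes time polynomial in q^p and the input size.

  For the machine model, the algorithm is written in a language whose only loops are counted
  loops. Such a program has a total semantics, is easily compiled to a random access machine, and
  if no loop bound is modified inside its loop, its running time is at most a constant times the
  largest loop bound to the power of the nesting depth.
*)
theory Submission
  imports Defs
begin

section \<open>A loop language and its compilation\<close>

text \<open>The machine has no multiplication, but positions in the operation tables, numerals to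
  base q and the power q^min(p, d) need it. Products are computed by repeated addition, with q, d, m
  or h as the loop bound. The counts, which may reach m^k, are only added and never bound a loop, so
  their size does not affect the number of steps.

  One number bounds all loops, namely q^p times the input size n: the table has q^min(p, d) + 1
  \<le> 2 q^p entries, and d, m, h and k are at most n because the matrices are written out entry by
  entry and k is in unary. For nesting depth D the time is at most K q^(p D) n^D with a constant K.
  The factor K is absorbed by n^K, so f(q, p) = q^(p D).

  The loop bounds are themselves results of computations, so the whole program does modify its loop
  bounds. The setup is therefore cut into phases, each of which leaves its own loop bounds alone,
  and the time is bounded phase by phase.\<close>

datatype atom = Cn nat | Vr nat

text \<open>Second operands are atoms, so that an expression can be evaluated in the accumulator
  without a stack of intermediate results.\<close>

datatype expr =
    At atom
  | Plus expr atom
  | Minus expr atom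
  | Inp expr
  | Get nat expr

text \<open>\<open>Scan\<close> is the one loop that is not counted. It measures a block of nonzero
  input numbers and is there to read the unary number k.\<close>

datatype com =
    Skip
  | Assign nat expr (infix "::=" 62)
  | Put nat nat expr
  | Scan nat nat
  | Seq com com (infixr ";;" 60)
  | If expr com com
  | For nat nat com

type_synonym state = "(nat \<Rightarrow> nat) \<times> (nat \<Rightarrow> nat \<Rightarrow> nat)"

definition rd :: "nat list \<Rightarrow> nat \<Rightarrow> nat" where
  "rd xs i = (if i < length xs then xs ! i else 0)"

fun atom_val :: "state \<Rightarrow> atom \<Rightarrow> nat" where
  "atom_val s (Cn c) = c"
| "atom_val s (Vr x) = fst s x"

fun eval :: "nat list \<Rightarrow> state \<Rightarrow> expr \<Rightarrow> nat" where
  "eval xs s (At a) = atom_val s a"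
| "eval xs s (Plus e a) = eval xs s e + atom_val s a"
| "eval xs s (Minus e a) = eval xs s e - atom_val s a"
| "eval xs s (Inp e) = rd xs (eval xs s e)"
| "eval xs s (Get a e) = snd s a (eval xs s e)"

definition setv :: "nat \<Rightarrow> nat \<Rightarrow> state \<Rightarrow> state" where
  "setv x n s = ((fst s)(x := n), snd s)"

definition seta :: "nat \<Rightarrow> nat \<Rightarrow> nat \<Rightarrow> state \<Rightarrow> state" where
  "seta a i n s = (fst s, (snd s)(a := (snd s a)(i := n)))"

lemma fst_setv [simp]: "fst (setv x n s) = (fst s)(x := n)"
  and snd_setv [simp]: "snd (setv x n s) = snd s"
  and fst_seta [simp]: "fst (seta a i n s) = fst s"
  and snd_seta [simp]: "snd (seta a i n s) = (snd s)(a := (snd s a)(i := n))"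
  by (simp_all add: setv_def seta_def)

text \<open>The minimum always exists because \<open>rd\<close> yields 0 beyond the end of the
  input; this makes \<open>Scan\<close> total.\<close>

definition unary_at :: "nat list \<Rightarrow> nat \<Rightarrow> nat" where
  "unary_at xs i = (LEAST n. rd xs (i + n) = 0)"

primrec run :: "nat list \<Rightarrow> com \<Rightarrow> state \<Rightarrow> state" where
  "run xs Skip s = s"
| "run xs (x ::= e) s = setv x (eval xs s e) s"
| "run xs (Put a x e) s = seta a (fst s x) (eval xs s e) s"
| "run xs (Scan x y) s = setv x (unary_at xs (fst s y)) s"
| "run xs (c1 ;; c2) s = run xs c2 (run xs c1 s)"
| "run xs (If e c1 c2) s = (if 0 < eval xs s e then run xs c1 s else run xs c2 s)"
| "run xs (For i n c) s =
     ((\<lambda>s. setv i (Suc (fst s i)) (run xs c s)) ^^ fst s n) (setv i 0 s)"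

section \<open>Translation into machine code and exact running times\<close>

fun atom_op :: "atom \<Rightarrow> operand" where
  "atom_op (Cn c) = Imm c"
| "atom_op (Vr x) = Reg (2 * x + 4)"

text \<open>
  Register 0 is the accumulator and registers 1 and 2 are scratch space. The variables live in
  the remaining even registers and the four arrays, interleaved, in the remaining odd ones, so
  that none of them has to be given a size.
\<close>

definition addr_code :: "nat \<Rightarrow> instr list" where
  "addr_code a = [STORE 1, ADD (Reg 1), STORE 1, ADD (Reg 1), STORE 1, ADD (Reg 1),
     ADD (Imm (2 * a + 3)), STORE 1]"

fun expr_code :: "expr \<Rightarrow> instr list" where
  "expr_code (At a) = [LOAD (atom_op a)]"
| "expr_code (Plus e a) = expr_code e @ [ADD (atom_op a)]"
| "expr_code (Minus e a) = expr_code e @ [SUB (atom_op a)]"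
| "expr_code (Inp e) = expr_code e @ [STORE 1, READ (Reg 1)]"
| "expr_code (Get a e) = expr_code e @ addr_code a @ [LOAD (Ind 1)]"

definition put_code :: "nat \<Rightarrow> nat \<Rightarrow> expr \<Rightarrow> instr list" where
  "put_code a x e = expr_code e @ [STORE 2, LOAD (Reg (2 * x + 4))] @ addr_code a @
     [LOAD (Reg 2), STORE_IND 1]"

text \<open>Jump targets are absolute, so the code of a command depends on its start address. Its
  length does not, and is needed to place targets behind code that is yet to be generated.\<close>

primrec code_len :: "com \<Rightarrow> nat" where
  "code_len Skip = 0"
| "code_len (x ::= e) = length (expr_code e) + 1"
| "code_len (Put a x e) = length (put_code a x e)"
| "code_len (Scan x y) = 11"
| "code_len (c1 ;; c2) = code_len c1 + code_len c2"
| "code_len (If e c1 c2) = length (expr_code e) + code_len c1 + code_len c2 + 2"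
| "code_len (For i n c) = code_len c + 9"

primrec code :: "com \<Rightarrow> nat \<Rightarrow> instr list" where
  "code Skip l = []"
| "code (x ::= e) l = expr_code e @ [STORE (2 * x + 4)]"
| "code (Put a x e) l = put_code a x e"
| "code (Scan x y) l =
     [LOAD (Imm 0), STORE (2 * x + 4),
      LOAD (Reg (2 * y + 4)), ADD (Reg (2 * x + 4)), STORE 1, READ (Reg 1), JZERO (l + 11),
      LOAD (Reg (2 * x + 4)), ADD (Imm 1), STORE (2 * x + 4), JUMP (l + 2)]"
| "code (c1 ;; c2) l = code c1 l @ code c2 (l + code_len c1)"
| "code (If e c1 c2) l =
     (let l1 = l + length (expr_code e) + 1; l2 = l1 + code_len c1 + 1 in
      expr_code e @ JZERO l2 # code c1 l1 @ JUMP (l2 + code_len c2) # code c2 l2)"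
| "code (For i n c) l =
     [LOAD (Imm 0), STORE (2 * i + 4),
      LOAD (Reg (2 * n + 4)), SUB (Reg (2 * i + 4)), JZERO (l + code_len c + 9)] @
     code c (l + 5) @
     [LOAD (Reg (2 * i + 4)), ADD (Imm 1), STORE (2 * i + 4), JUMP (l + 2)]"

text \<open>Exact step counts. A counted loop takes 2 steps to reset the counter and 3 for the last
  test; a round adds 3 for the test, 3 for the increment and 1 for the jump back.
  \<open>Scan\<close> takes 2 steps for the reset, 5 for the last test and 9 per round.\<close>

primrec cost :: "nat list \<Rightarrow> com \<Rightarrow> state \<Rightarrow> nat" where
  "cost xs Skip s = 0"
| "cost xs (x ::= e) s = length (expr_code e) + 1"
| "cost xs (Put a x e) s = length (put_code a x e)"
| "cost xs (Scan x y) s = 9 * unary_at xs (fst s y) + 7"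
| "cost xs (c1 ;; c2) s = cost xs c1 s + cost xs c2 (run xs c1 s)"
| "cost xs (If e c1 c2) s =
     length (expr_code e) + 1 + (if 0 < eval xs s e then cost xs c1 s + 1 else cost xs c2 s)"
| "cost xs (For i n c) s =
     5 + (\<Sum>k<fst s n.
       7 + cost xs c (((\<lambda>s. setv i (Suc (fst s i)) (run xs c s)) ^^ k) (setv i 0 s)))"

primrec mods :: "com \<Rightarrow> nat set" where
  "mods Skip = {}"
| "mods (x ::= e) = {x}"
| "mods (Put a x e) = {}"
| "mods (Scan x y) = {x}"
| "mods (c1 ;; c2) = mods c1 \<union> mods c2"
| "mods (If e c1 c2) = mods c1 \<union> mods c2"
| "mods (For i n c) = insert i (mods c)"

primrec mods_arr :: "com \<Rightarrow> nat set" where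
  "mods_arr Skip = {}"
| "mods_arr (x ::= e) = {}"
| "mods_arr (Put a x e) = {a}"
| "mods_arr (Scan x y) = {}"
| "mods_arr (c1 ;; c2) = mods_arr c1 \<union> mods_arr c2"
| "mods_arr (If e c1 c2) = mods_arr c1 \<union> mods_arr c2"
| "mods_arr (For i n c) = mods_arr c"

fun wf_expr :: "expr \<Rightarrow> bool" where
  "wf_expr (At a) = True"
| "wf_expr (Plus e a) = wf_expr e"
| "wf_expr (Minus e a) = wf_expr e"
| "wf_expr (Inp e) = wf_expr e"
| "wf_expr (Get a e) = (a < 4 \<and> wf_expr e)"

text \<open>In the semantics the number of rounds is fixed on entry to a loop, while the compiled
  loop compares bound and counter before each round; the two agree because the body changes neither.
  \<open>Scan\<close> resets \<open>x\<close> before it uses \<open>y\<close>, hence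
  \<open>x \<noteq> y\<close>. The register layout has room for four arrays.\<close>

primrec wf_com :: "com \<Rightarrow> bool" where
  "wf_com Skip = True"
| "wf_com (x ::= e) = wf_expr e"
| "wf_com (Put a x e) = (a < 4 \<and> wf_expr e)"
| "wf_com (Scan x y) = (x \<noteq> y)"
| "wf_com (c1 ;; c2) = (wf_com c1 \<and> wf_com c2)"
| "wf_com (If e c1 c2) = (wf_expr e \<and> wf_com c1 \<and> wf_com c2)"
| "wf_com (For i n c) = (i \<noteq> n \<and> i \<notin> mods c \<and> n \<notin> mods c \<and> wf_com c)"

section \<open>Frame conditions and an invariant rule for counted loops\<close>

definition agree :: "com \<Rightarrow> state \<Rightarrow> state \<Rightarrow> bool" where
  "agree c s s' \<longleftrightarrow>
     (\<forall>x. x \<notin> mods c \<longrightarrow> fst s' x = fst s x) \<and> (\<forall>a. a \<notin> mods_arr c \<longrightarrow> snd s' a = snd s a)"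

lemma agreeD:
  assumes "agree c s s'"
  shows "x \<notin> mods c \<Longrightarrow> fst s' x = fst s x" "a \<notin> mods_arr c \<Longrightarrow> snd s' a = snd s a"
  using assms by (simp_all add: agree_def)

definition for_iter :: "nat list \<Rightarrow> nat \<Rightarrow> com \<Rightarrow> state \<Rightarrow> state" where
  "for_iter xs i c s = setv i (Suc (fst s i)) (run xs c s)"

lemma for_iter_simps:
  "fst (for_iter xs i c s) = (fst (run xs c s))(i := Suc (fst s i))"
  "snd (for_iter xs i c s) = snd (run xs c s)"
  by (simp_all add: for_iter_def)

lemma run_For: "run xs (For i n c) s = (for_iter xs i c ^^ fst s n) (setv i 0 s)"
  by (simp add: for_iter_def[abs_def])

lemma cost_For:
  "cost xs (For i n c) s =
     5 + (\<Sum>k<fst s n. 7 + cost xs c ((for_iter xs i c ^^ k) (setv i 0 s)))"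
  by (simp add: for_iter_def[abs_def])

lemma agree_run: "agree c s (run xs c s)"
proof (induction c arbitrary: s)
  case (Seq c1 c2)
  from Seq(1)[of s] Seq(2)[of "run xs c1 s"] show ?case by (simp add: agree_def)
next
  case (For i n c)
  have "agree (For i n c) s ((for_iter xs i c ^^ k) (setv i 0 s))" for k
  proof (induction k)
    case 0
    then show ?case by (simp add: agree_def)
  next
    case (Suc k)
    then show ?case
      using For[of "(for_iter xs i c ^^ k) (setv i 0 s)"]
      by (simp add: agree_def for_iter_simps)
  qed
  then show ?case by (simp only: run_For)
qed (auto simp: agree_def)

lemmas run_mods = agreeD(1)[OF agree_run] and run_mods_arr = agreeD(2)[OF agree_run]

lemma for_iter_counter: "i \<notin> mods c \<Longrightarrow> fst ((for_iter xs i c ^^ k) (setv i 0 s)) i = k"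
  by (induction k) (simp_all add: for_iter_simps)

lemma for_iter_agree: "agree (For i n c) s ((for_iter xs i c ^^ k) (setv i 0 s))"
proof (induction k)
  case 0
  show ?case by (simp add: agree_def)
next
  case (Suc k)
  then show ?case
    using agree_run[of c "(for_iter xs i c ^^ k) (setv i 0 s)" xs]
    by (simp add: agree_def for_iter_simps)
qed

text \<open>The invariant is indexed by the number of completed rounds. The premise with
  \<open>agree\<close> says that whatever the loop does not assign still has its initial value, so
  that an invariant has to mention only what changes.\<close>

lemma For_rule:
  assumes "wf_com (For i n c)"
    and "I 0 (setv i 0 s)"
    and "\<And>k s'. k < fst s n \<Longrightarrow> fst s' i = k \<Longrightarrow> agree (For i n c) s s' \<Longrightarrow> I k s' \<Longrightarrow>
      I (Suc k) (setv i (Suc k) (run xs c s'))"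
  shows "I (fst s n) (run xs (For i n c) s)"
proof -
  have i: "i \<notin> mods c" using assms(1) by simp
  have "k \<le> fst s n \<Longrightarrow> I k ((for_iter xs i c ^^ k) (setv i 0 s))" for k
  proof (induction k)
    case 0
    then show ?case using assms(2) by simp
  next
    case (Suc k)
    let ?s = "(for_iter xs i c ^^ k) (setv i 0 s)"
    have "I (Suc k) (setv i (Suc k) (run xs c ?s))"
      using Suc(1,2) by (intro assms(3) for_iter_agree for_iter_counter[OF i]) auto
    moreover have "(for_iter xs i c ^^ Suc k) (setv i 0 s) = setv i (Suc k) (run xs c ?s)"
      using for_iter_counter[OF i, where xs = xs and k = k and s = s] by (simp only: funpow.simps comp_apply for_iter_def)
    ultimately show ?case by (simp only:)
  qed
  then show ?thesis by (simp only: run_For)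
qed

subsection \<open>Correctness of the compilation\<close>

definition code_at :: "ram \<Rightarrow> nat \<Rightarrow> instr list \<Rightarrow> bool" where
  "code_at P l cs \<longleftrightarrow> l + length cs \<le> length P \<and> (\<forall>i<length cs. P ! (l + i) = cs ! i)"

lemma code_at_Nil [simp]: "code_at P l [] \<longleftrightarrow> l \<le> length P"
  by (simp add: code_at_def)

lemma code_at_Cons:
  "code_at P l (c # cs) \<longleftrightarrow> l < length P \<and> P ! l = c \<and> code_at P (Suc l) cs"
  unfolding code_at_def by (auto simp: less_Suc_eq_0_disj)

lemma code_at_nth:
  "code_at P l cs \<Longrightarrow> i < length cs \<Longrightarrow> l + i < length P \<and> P ! (l + i) = cs ! i"
  by (simp add: code_at_def)

lemma code_at_append:
  "code_at P l (cs @ ds) \<longleftrightarrow> code_at P l cs \<and> code_at P (l + length cs) ds"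
proof (induction cs arbitrary: l)
  case Nil
  then show ?case by (auto simp: code_at_def)
next
  case (Cons c cs)
  then show ?case by (auto simp: code_at_Cons)
qed

lemma length_code [simp]: "length (code c l) = code_len c"
  by (induction c arbitrary: l) (simp_all add: Let_def)

definition steps :: "ram \<Rightarrow> nat list \<Rightarrow> nat \<Rightarrow> config \<Rightarrow> config \<Rightarrow> bool" where
  "steps P xs t a b \<longleftrightarrow> (ram_step P xs ^^ t) a = b"

lemma steps_0: "steps P xs 0 a a"
  by (simp add: steps_def)

lemma steps_trans: "steps P xs t a b \<Longrightarrow> steps P xs u b c \<Longrightarrow> steps P xs (t + u) a c"
  by (simp add: steps_def add.commute[of t u] funpow_add)

lemma steps_Suc:
  assumes "l < length P" "steps P xs t (exec_instr xs (P ! l) (l, r)) c"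
  shows "steps P xs (Suc t) (l, r) c"
  using assms by (simp add: steps_def funpow_Suc_right ram_step_def halted_def del: funpow.simps)

fun straight :: "instr \<Rightarrow> bool" where
  "straight (JUMP l) = False"
| "straight (JPOS l) = False"
| "straight (JZERO l) = False"
| "straight _ = True"

text \<open>Jump-free code acts on the registers as a function that does not depend on its position
  in the program, so its effect can be computed by rewriting.\<close>

fun exec_all :: "nat list \<Rightarrow> instr list \<Rightarrow> (nat \<Rightarrow> nat) \<Rightarrow> nat \<Rightarrow> nat" where
  "exec_all xs [] r = r"
| "exec_all xs (c # cs) r = exec_all xs cs (snd (exec_instr xs c (0, r)))"

lemma exec_all_append [simp]: "exec_all xs (cs @ ds) r = exec_all xs ds (exec_all xs cs r)"
  by (induction cs arbitrary: r) simp_all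

lemma exec_straight:
  "straight c \<Longrightarrow> exec_instr xs c (l, r) = (Suc l, snd (exec_instr xs c (0, r)))"
  by (cases c) simp_all

lemma steps_straight:
  assumes "code_at P l cs" "\<forall>c\<in>set cs. straight c" "n = length cs" "l' = l + n"
  shows "steps P xs n (l, r) (l', exec_all xs cs r)"
  using assms
proof (induction cs arbitrary: l r n l')
  case Nil
  then show ?case by (simp add: steps_0)
next
  case (Cons c cs)
  have P: "l < length P" "P ! l = c" using Cons(2) by (simp_all add: code_at_Cons)
  have "steps P xs (length cs) (Suc l, snd (exec_instr xs c (0, r)))
      (l', exec_all xs cs (snd (exec_instr xs c (0, r))))"
    using Cons(2-5) by (intro Cons(1)) (simp_all add: code_at_Cons)
  then have "steps P xs (length cs) (exec_instr xs (P ! l) (l, r)) (l', exec_all xs (c # cs) r)"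
    using exec_straight[of c xs l r] Cons(3) P(2) by simp
  then show ?case using steps_Suc[OF P(1)] Cons(4) by simp
qed

lemma straight_expr: "\<forall>c\<in>set (expr_code e). straight c"
  by (induction e) (auto simp: addr_code_def)

definition rel :: "state \<Rightarrow> (nat \<Rightarrow> nat) \<Rightarrow> bool" where
  "rel s r \<longleftrightarrow>
     (\<forall>x. r (2 * x + 4) = fst s x) \<and> (\<forall>a<4. \<forall>i. r (8 * i + 2 * a + 3) = snd s a i)"

text \<open>Registers 0 to 2 are scratch space that \<open>rel\<close> leaves unconstrained.\<close>

lemma rel_cong:
  assumes "rel s r" "\<And>j. 2 < j \<Longrightarrow> r' j = r j"
  shows "rel s r'"
  using assms unfolding rel_def by simp

lemma operand_val_atom: "rel s r \<Longrightarrow> operand_val r (atom_op a) = atom_val s a"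
  by (cases a) (simp_all add: rel_def)

text \<open>Each pair \<open>STORE 1\<close>, \<open>ADD (Reg 1)\<close> doubles the accumulator.
  Three doublings give the factor 8, the distance between neighbouring cells of one array when four
  arrays share the odd registers.\<close>

lemma exec_addr_code:
  "exec_all xs (addr_code a) r =
     r(0 := 8 * r 0 + 2 * a + 3, 1 := 8 * r 0 + 2 * a + 3)"
  by (auto simp: addr_code_def fun_eq_iff)

lemma exec_expr_code:
  assumes "rel s r" "wf_expr e"
  shows "exec_all xs (expr_code e) r 0 = eval xs s e \<and>
    (\<forall>j>1. exec_all xs (expr_code e) r j = r j)"
  using assms(2)
proof (induction e)
  case (At a)
  then show ?case using assms(1) by (simp add: operand_val_atom)
next
  case (Plus e a)
  then have "rel s (exec_all xs (expr_code e) r)" by (intro rel_cong[OF assms(1)]) auto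
  then show ?case using Plus by (simp add: operand_val_atom)
next
  case (Minus e a)
  then have "rel s (exec_all xs (expr_code e) r)" by (intro rel_cong[OF assms(1)]) auto
  then show ?case using Minus by (simp add: operand_val_atom)
next
  case (Inp e)
  then show ?case by (simp add: rd_def)
next
  case (Get a e)
  then have "rel s (exec_all xs (expr_code e) r)" by (intro rel_cong[OF assms(1)]) auto
  then show ?case using Get by (simp add: exec_addr_code rel_def)
qed

lemma rel_setv:
  assumes "rel s r" shows "rel (setv x n s) (r(2 * x + 4 := n))"
proof -
  have "8 * i + 2 * a + 3 \<noteq> 2 * x + 4" for i a :: nat by presburger
  then show ?thesis using assms by (simp add: rel_def)
qed

lemma rel_seta:
  assumes "rel s r" "a < 4" shows "rel (seta a i n s) (r(8 * i + 2 * a + 3 := n))"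
proof -
  have 1: "2 * x + 4 \<noteq> 8 * i + 2 * a + 3" for x by presburger
  have 2: "8 * j + 2 * b + 3 = 8 * i + 2 * a + 3 \<longleftrightarrow> j = i \<and> b = a" if "b < 4" for j b
  proof
    \<comment> \<open>With \<open>b < 4\<close> and \<open>a < 4\<close>, division by 4 recovers
      cell and array, so distinct cells lie in distinct registers.\<close>
    assume "8 * j + 2 * b + 3 = 8 * i + 2 * a + 3"
    then have "4 * j + b = 4 * i + a" by simp
    moreover have "(4 * j + b) div 4 = j" "(4 * i + a) div 4 = i" using that assms(2) by auto
    ultimately show "j = i \<and> b = a" by simp
  qed simp
  show ?thesis using assms 1 2 by (simp add: rel_def)
qed

lemma unary_at_props:
  shows "rd xs (i + unary_at xs i) = 0" "k < unary_at xs i \<Longrightarrow> rd xs (i + k) \<noteq> 0"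
proof -
  have "rd xs (i + length xs) = 0" by (simp add: rd_def)
  then show "rd xs (i + unary_at xs i) = 0" unfolding unary_at_def by (rule LeastI)
  show "k < unary_at xs i \<Longrightarrow> rd xs (i + k) \<noteq> 0"
    unfolding unary_at_def by (rule not_less_Least)
qed

lemma steps_JZERO:
  assumes "l < length P \<and> P ! l = JZERO k"
  shows "r 0 = 0 \<Longrightarrow> steps P xs 1 (l, r) (k, r)"
    and "r 0 \<noteq> 0 \<Longrightarrow> l' = Suc l \<Longrightarrow> steps P xs 1 (l, r) (l', r)"
  unfolding One_nat_def using assms by (auto intro!: steps_Suc simp: steps_0)

lemma steps_JUMP:
  assumes "l < length P \<and> P ! l = JUMP k"
  shows "steps P xs 1 (l, r) (k, r)"
  unfolding One_nat_def using assms by (intro steps_Suc) (simp_all add: steps_0)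

text \<open>Induction on the number \<open>j\<close> of rounds still to be made, for an arbitrary
  value of the counter, so that the hypothesis applies to the state after one round.\<close>

lemma scan_loop:
  assumes code: "code_at P l (code (Scan x y) l)" and "x \<noteq> y" and "rel s r"
    and "j + fst s x = unary_at xs (fst s y)"
  shows "\<exists>r'. steps P xs (9 * j + 5) (l + 2, r) (l + 11, r') \<and>
    rel (setv x (unary_at xs (fst s y)) s) r'"
  using assms(3,4)
proof (induction j arbitrary: s r)
  case (0 s r)
  note rel = 0(1)
  let ?test = "[LOAD (Reg (2 * y + 4)), ADD (Reg (2 * x + 4)), STORE 1, READ (Reg 1)]"
  let ?r = "exec_all xs ?test r"
  have r: "r (2 * y + 4) = fst s y" "r (2 * x + 4) = fst s x"
    using rel by (simp_all add: rel_def)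
  have "code_at P (l + 2) ?test" using code by (simp add: code_at_Cons)
  then have 1: "steps P xs 4 (l + 2, r) (l + 6, ?r)"
    by (intro steps_straight) simp_all
  have "rd xs (fst s y + fst s x) = 0" using unary_at_props(1)[of xs "fst s y"] 0 by simp
  then have "?r 0 = 0" using r by (simp add: rd_def)
  then have 2: "steps P xs 1 (l + 6, ?r) (l + 11, ?r)"
    using code_at_nth[OF code, of 6] by (intro steps_JZERO(1)) simp_all
  have "setv x (unary_at xs (fst s y)) s = s" using 0(2) by (simp add: setv_def flip: 0(2))
  moreover have "rel s ?r" by (rule rel_cong[OF rel]) simp
  ultimately show ?case using steps_trans[OF 1 2] by auto
next
  case (Suc j s r)
  note rel = Suc(2)
  let ?test = "[LOAD (Reg (2 * y + 4)), ADD (Reg (2 * x + 4)), STORE 1, READ (Reg 1)]"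
  let ?incr = "[LOAD (Reg (2 * x + 4)), ADD (Imm 1), STORE (2 * x + 4)]"
  let ?r = "exec_all xs ?test r"
  let ?r' = "exec_all xs ?incr ?r"
  let ?s' = "setv x (Suc (fst s x)) s"
  have r: "r (2 * y + 4) = fst s y" "r (2 * x + 4) = fst s x"
    using rel by (simp_all add: rel_def)
  have "code_at P (l + 2) ?test" using code by (simp add: code_at_Cons)
  then have 1: "steps P xs 4 (l + 2, r) (l + 6, ?r)"
    by (intro steps_straight) simp_all
  have "rd xs (fst s y + fst s x) \<noteq> 0"
    by (rule unary_at_props(2)) (use Suc(3) in simp)
  then have "?r 0 \<noteq> 0" using r by (simp add: rd_def split: if_splits)
  then have 2: "steps P xs 1 (l + 6, ?r) (l + 7, ?r)"
    using code_at_nth[OF code, of 6] by (intro steps_JZERO(2)) simp_all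
  have "code_at P (l + 7) ?incr" using code by (simp add: code_at_Cons numeral_eq_Suc)
  then have 3: "steps P xs 3 (l + 7, ?r) (l + 10, ?r')"
    by (intro steps_straight) simp_all
  have 4: "steps P xs 1 (l + 10, ?r') (l + 2, ?r')"
    using code_at_nth[OF code, of 10] by (intro steps_JUMP) simp_all
  have "rel ?s' ?r'"
    by (rule rel_cong[OF rel_setv[OF rel]]) (use r in simp)
  moreover have "j + fst ?s' x = unary_at xs (fst ?s' y)" using Suc(3) \<open>x \<noteq> y\<close> by simp
  ultimately obtain r' where 5: "steps P xs (9 * j + 5) (l + 2, ?r') (l + 11, r')"
    and r': "rel (setv x (unary_at xs (fst ?s' y)) ?s') r'"
    using Suc(1) by blast
  have "setv x (unary_at xs (fst ?s' y)) ?s' = setv x (unary_at xs (fst s y)) s"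
    using \<open>x \<noteq> y\<close> by (simp add: setv_def)
  moreover have eq: "4 + (1 + (3 + (1 + (9 * j + 5)))) = 9 * Suc j + 5" by simp
  note steps_trans[OF 1 steps_trans[OF 2 steps_trans[OF 3 steps_trans[OF 4 5]]], unfolded eq]
  ultimately show ?case using r' by auto
qed

lemma steps_expr:
  assumes "code_at P l (expr_code e)" "rel s r" "wf_expr e"
  obtains r' where "steps P xs (length (expr_code e)) (l, r) (l + length (expr_code e), r')"
    and "r' 0 = eval xs s e" and "rel s r'"
proof
  show "steps P xs (length (expr_code e)) (l, r)
      (l + length (expr_code e), exec_all xs (expr_code e) r)"
    by (intro steps_straight assms straight_expr refl)
  show "exec_all xs (expr_code e) r 0 = eval xs s e"
    using exec_expr_code[OF assms(2,3)] by simp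
  show "rel s (exec_all xs (expr_code e) r)"
    by (rule rel_cong[OF assms(2)]) (use exec_expr_code[OF assms(2,3)] in simp)
qed

lemma for_loop:
  assumes code: "code_at P l (code (For i n c) l)" and wf: "wf_com (For i n c)"
    and body: "\<And>s r. rel s r \<Longrightarrow>
      \<exists>r'. steps P xs (cost xs c s) (l + 5, r) (l + 5 + code_len c, r') \<and> rel (run xs c s) r'"
    and "rel s r" and "j + fst s i = fst s n"
  shows "\<exists>r'. steps P xs (3 + (\<Sum>k<j. 7 + cost xs c ((for_iter xs i c ^^ k) s)))
      (l + 2, r) (l + code_len c + 9, r') \<and> rel ((for_iter xs i c ^^ j) s) r'"
  using assms(4,5)
proof (induction j arbitrary: s r)
  case (0 s r)
  note rel = 0(1)
  let ?test = "[LOAD (Reg (2 * n + 4)), SUB (Reg (2 * i + 4))]"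
  let ?r = "exec_all xs ?test r"
  have r: "r (2 * n + 4) = fst s n" "r (2 * i + 4) = fst s i"
    using rel by (simp_all add: rel_def)
  have "code_at P (l + 2) ?test" using code by (simp add: code_at_Cons code_at_append)
  then have 1: "steps P xs 2 (l + 2, r) (l + 4, ?r)"
    by (intro steps_straight) simp_all
  have "?r 0 = 0" using r 0 by simp
  then have 2: "steps P xs 1 (l + 4, ?r) (l + code_len c + 9, ?r)"
    using code_at_nth[OF code, of 4] by (intro steps_JZERO(1)) simp_all
  have "rel s ?r" by (rule rel_cong[OF rel]) simp
  then show ?case using steps_trans[OF 1 2] by auto
next
  case (Suc j s r)
  note rel = Suc(2)
  let ?test = "[LOAD (Reg (2 * n + 4)), SUB (Reg (2 * i + 4))]"
  let ?incr = "[LOAD (Reg (2 * i + 4)), ADD (Imm 1), STORE (2 * i + 4)]"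
  let ?r = "exec_all xs ?test r"
  let ?s = "for_iter xs i c s"
  have r: "r (2 * n + 4) = fst s n" "r (2 * i + 4) = fst s i"
    using rel by (simp_all add: rel_def)
  have "code_at P (l + 2) ?test" using code by (simp add: code_at_Cons code_at_append)
  then have 1: "steps P xs 2 (l + 2, r) (l + 4, ?r)"
    by (intro steps_straight) simp_all
  have "?r 0 \<noteq> 0" using r Suc(3) by simp
  then have 2: "steps P xs 1 (l + 4, ?r) (l + 5, ?r)"
    using code_at_nth[OF code, of 4] by (intro steps_JZERO(2)) simp_all
  have "rel s ?r" by (rule rel_cong[OF rel]) simp
  from body[OF this] obtain r1 where
    3: "steps P xs (cost xs c s) (l + 5, ?r) (l + 5 + code_len c, r1)"
    and r1: "rel (run xs c s) r1" by blast
  let ?r2 = "exec_all xs ?incr r1"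
  have ri: "r1 (2 * i + 4) = fst s i"
    using r1 wf by (simp add: rel_def run_mods)
  have c2: "code_at P (l + 5 + code_len c) (?incr @ [JUMP (l + 2)])"
    using code by (simp add: code_at_Cons code_at_append numeral_eq_Suc)
  then have "code_at P (l + 5 + code_len c) ?incr" by (simp add: code_at_Cons)
  then have 4: "steps P xs 3 (l + 5 + code_len c, r1) (l + 8 + code_len c, ?r2)"
    by (intro steps_straight) simp_all
  have 5: "steps P xs 1 (l + 8 + code_len c, ?r2) (l + 2, ?r2)"
    using code_at_nth[OF c2, of 3]
    by (intro steps_JUMP) (simp add: numeral_eq_Suc)
  have "rel ?s ?r2" unfolding for_iter_def
    by (rule rel_cong[OF rel_setv[OF r1]]) (use ri wf in \<open>simp add: run_mods\<close>)
  moreover have "j + fst ?s i = fst ?s n"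
    using Suc(3) wf by (simp add: for_iter_def run_mods)
  ultimately obtain r' where 6: "steps P xs (3 + (\<Sum>k<j. 7 + cost xs c ((for_iter xs i c ^^ k) ?s)))
      (l + 2, ?r2) (l + code_len c + 9, r')" and r': "rel ((for_iter xs i c ^^ j) ?s) r'"
    using Suc(1) by blast
  \<comment> \<open>The first round is split off the sum, since the induction hypothesis counts the
    iterates from the state after that round.\<close>
  have eq: "2 + (1 + (cost xs c s + (3 + (1 + (3 + (\<Sum>k<j. 7 + cost xs c ((for_iter xs i c ^^ k) ?s))))))) =
      3 + (\<Sum>k<Suc j. 7 + cost xs c ((for_iter xs i c ^^ k) s))"
    by (subst sum.lessThan_Suc_shift) (simp add: funpow_Suc_right del: funpow.simps)
  have "(for_iter xs i c ^^ Suc j) s = (for_iter xs i c ^^ j) ?s"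
    by (simp add: funpow_Suc_right del: funpow.simps)
  then have "rel ((for_iter xs i c ^^ Suc j) s) r'" using r' by (simp only:)
  with steps_trans[OF 1 steps_trans[OF 2 steps_trans[OF 3 steps_trans[OF 4 steps_trans[OF 5 6]]]],
      unfolded eq]
  show ?case by blast
qed

text \<open>A simulation with exact step counts. The start address is arbitrary because the code of
  a subcommand may lie anywhere in the program.\<close>

lemma code_correct:
  assumes "wf_com c" "code_at P l (code c l)" "rel s r"
  shows "\<exists>r'. steps P xs (cost xs c s) (l, r) (l + code_len c, r') \<and> rel (run xs c s) r'"
  using assms
proof (induction c arbitrary: l s r)
  case Skip
  then show ?case by (auto intro: steps_0)
next
  case (Assign x e)
  then obtain r1 where
    1: "steps P xs (length (expr_code e)) (l, r) (l + length (expr_code e), r1)"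
    and r1: "r1 0 = eval xs s e" "rel s r1"
    by (auto simp: code_at_append elim: steps_expr)
  have "steps P xs 1 (l + length (expr_code e), r1)
      (l + code_len (x ::= e), exec_all xs [STORE (2 * x + 4)] r1)"
    using Assign(2) by (intro steps_straight) (simp_all add: code_at_append)
  from steps_trans[OF 1 this] have "steps P xs (cost xs (x ::= e) s) (l, r)
      (l + code_len (x ::= e), r1(2 * x + 4 := r1 0))" by simp
  moreover have "rel (run xs (x ::= e) s) (r1(2 * x + 4 := r1 0))"
    using rel_setv[OF r1(2)] r1(1) by simp
  ultimately show ?case by blast
next
  case (Put a x e)
  let ?r1 = "exec_all xs (expr_code e) r"
  have "steps P xs (length (put_code a x e)) (l, r)
      (l + length (put_code a x e), exec_all xs (put_code a x e) r)"
    using Put straight_expr[of e]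
    by (intro steps_straight) (auto simp: put_code_def addr_code_def)
  moreover have "rel (run xs (Put a x e) s) (exec_all xs (put_code a x e) r)"
  proof -
    let ?a = "8 * fst s x + 2 * a + 3"
    have e: "?r1 0 = eval xs s e" "\<And>j. 1 < j \<Longrightarrow> ?r1 j = r j"
      using exec_expr_code[OF Put(3), of e xs] Put(1) by auto
    have "?r1 (2 * x + 4) = fst s x" using e(2) Put(3) by (simp add: rel_def)
    then have "exec_all xs (put_code a x e) r j = (r(?a := eval xs s e)) j" if "2 < j" for j
      using that e by (simp add: put_code_def exec_addr_code)
    then show ?thesis using rel_cong[OF rel_seta[OF Put(3)]] Put(1) by simp
  qed
  ultimately show ?case by auto
next
  case (Scan x y)
  let ?init = "[LOAD (Imm 0), STORE (2 * x + 4)]"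
  let ?r = "exec_all xs ?init r"
  have "code_at P l ?init" using Scan(2) by (simp add: code_at_Cons)
  then have 1: "steps P xs 2 (l, r) (l + 2, ?r)"
    by (intro steps_straight) simp_all
  have xy: "x \<noteq> y" using Scan(1) by simp
  have "rel (setv x 0 s) ?r" by (rule rel_cong[OF rel_setv[OF Scan(3)]]) simp
  moreover have "unary_at xs (fst s y) + fst (setv x 0 s) x = unary_at xs (fst (setv x 0 s) y)"
    using xy by simp
  ultimately obtain r' where
    2: "steps P xs (9 * unary_at xs (fst s y) + 5) (l + 2, ?r) (l + 11, r')"
    and r': "rel (setv x (unary_at xs (fst (setv x 0 s) y)) (setv x 0 s)) r'"
    using scan_loop[OF Scan(2) xy] by blast
  have "setv x (unary_at xs (fst (setv x 0 s) y)) (setv x 0 s) = run xs (Scan x y) s"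
    using xy by (simp add: setv_def)
  then have "rel (run xs (Scan x y) s) r'" using r' by (simp only:)
  moreover have eq: "2 + (9 * unary_at xs (fst s y) + 5) = cost xs (Scan x y) s" by simp
  note steps_trans[OF 1 2, unfolded eq]
  ultimately show ?case by auto
next
  case (Seq c1 c2)
  have c: "code_at P l (code c1 l)" "code_at P (l + code_len c1) (code c2 (l + code_len c1))"
    and wf: "wf_com c1" "wf_com c2"
    using Seq(3,4) by (simp_all add: code_at_append)
  from Seq(1)[OF wf(1) c(1) Seq(5)] obtain r1 where
    1: "steps P xs (cost xs c1 s) (l, r) (l + code_len c1, r1)" and r1: "rel (run xs c1 s) r1"
    by blast
  from Seq(2)[OF wf(2) c(2) r1] obtain r2 where
    2: "steps P xs (cost xs c2 (run xs c1 s)) (l + code_len c1, r1)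
      (l + code_len c1 + code_len c2, r2)"
    and r2: "rel (run xs c2 (run xs c1 s)) r2"
    by blast
  show ?case using steps_trans[OF 1 2] r2 by (auto simp: add.assoc)
next
  case (If e c1 c2)
  define l0 where "l0 = l + length (expr_code e)"
  define l2 where "l2 = l0 + 1 + code_len c1 + 1"
  have c: "code_at P l (expr_code e)" "l0 < length P \<and> P ! l0 = JZERO l2"
      "code_at P (l0 + 1) (code c1 (l0 + 1))"
      "l0 + 1 + code_len c1 < length P \<and>
        P ! (l0 + 1 + code_len c1) = JUMP (l2 + code_len c2)"
      "code_at P l2 (code c2 l2)"
    and wf: "wf_expr e" "wf_com c1" "wf_com c2"
    using If(3,4) by (simp_all add: code_at_append code_at_Cons Let_def l0_def l2_def)
  from steps_expr[OF c(1) If(5) wf(1)] obtain r0 where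
    0: "steps P xs (length (expr_code e)) (l, r) (l0, r0)"
    and r0: "r0 0 = eval xs s e" "rel s r0" unfolding l0_def by blast
  show ?case
  proof (cases "0 < eval xs s e")
    case True
    from If(1)[OF wf(2) c(3) r0(2)] obtain r1 where
      2: "steps P xs (cost xs c1 s) (l0 + 1, r0) (l0 + 1 + code_len c1, r1)"
      and r1: "rel (run xs c1 s) r1" by blast
    have 3: "steps P xs 1 (l0 + 1 + code_len c1, r1) (l2 + code_len c2, r1)"
      using c by (intro steps_JUMP)
    have 1: "steps P xs 1 (l0, r0) (l0 + 1, r0)"
      using c True r0(1) by (intro steps_JZERO(2)) auto
    have "steps P xs (length (expr_code e) + (1 + (cost xs c1 s + 1))) (l, r)
        (l2 + code_len c2, r1)"
      by (rule steps_trans[OF 0 steps_trans[OF 1 steps_trans[OF 2 3]]])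
    moreover have "l2 + code_len c2 = l + code_len (If e c1 c2)"
      by (simp add: l2_def l0_def)
    ultimately show ?thesis using True r1 by (auto simp: algebra_simps)
  next
    case False
    from If(2)[OF wf(3) c(5) r0(2)] obtain r1 where
      2: "steps P xs (cost xs c2 s) (l2, r0) (l2 + code_len c2, r1)"
      and r1: "rel (run xs c2 s) r1" by blast
    have 1: "steps P xs 1 (l0, r0) (l2, r0)"
      using c False r0(1) by (intro steps_JZERO(1)) auto
    have "steps P xs (length (expr_code e) + (1 + cost xs c2 s)) (l, r)
        (l2 + code_len c2, r1)"
      by (rule steps_trans[OF 0 steps_trans[OF 1 2]])
    moreover have "l2 + code_len c2 = l + code_len (If e c1 c2)"
      by (simp add: l2_def l0_def)
    ultimately show ?thesis using False r1 by (auto simp: algebra_simps)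
  qed
next
  case (For i n c)
  let ?init = "[LOAD (Imm 0), STORE (2 * i + 4)]"
  let ?r = "exec_all xs ?init r"
  have "code_at P l ?init" using For(3) by (simp add: code_at_Cons)
  then have 1: "steps P xs 2 (l, r) (l + 2, ?r)"
    by (intro steps_straight) simp_all
  have rel: "rel (setv i 0 s) ?r" by (rule rel_cong[OF rel_setv[OF For(4)]]) simp
  have "code_at P (l + 5) (code c (l + 5))"
    using For(3) by (simp add: code_at_Cons code_at_append numeral_eq_Suc)
  then have body: "\<exists>r'. steps P xs (cost xs c s) (l + 5, r) (l + 5 + code_len c, r') \<and>
      rel (run xs c s) r'" if "rel s r" for s r
    using For(1,2) that by auto
  have "fst s n + fst (setv i 0 s) i = fst (setv i 0 s) n" using For(2) by simp
  from for_loop[OF For(3,2) body rel this] obtain r' where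
    2: "steps P xs (3 + (\<Sum>k<fst s n. 7 + cost xs c ((for_iter xs i c ^^ k) (setv i 0 s))))
      (l + 2, ?r) (l + code_len c + 9, r')"
    and r': "rel ((for_iter xs i c ^^ fst s n) (setv i 0 s)) r'" by blast
  have eq: "2 + (3 + (\<Sum>k<fst s n. 7 + cost xs c ((for_iter xs i c ^^ k) (setv i 0 s)))) =
    cost xs (For i n c) s" by (simp only: cost_For)
  have len: "l + code_len c + 9 = l + code_len (For i n c)" by simp
  from steps_trans[OF 1 2, unfolded eq len] r' show ?case unfolding run_For by blast
qed

definition init_state :: state where
  "init_state = (\<lambda>_. 0, \<lambda>_ _. 0)"

text \<open>The machine halts by running past the last instruction, with the value of
  \<open>e\<close> in the accumulator, which is also the output register.\<close>

definition compile :: "com \<Rightarrow> expr \<Rightarrow> ram" where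
  "compile c e = code c 0 @ expr_code e"

lemma ram_computes_compile:
  assumes "wf_com c" "wf_expr e" and "eval xs (run xs c init_state) e = y"
    and "cost xs c init_state + length (expr_code e) \<le> t"
  shows "ram_computes_within (compile c e) xs y t"
proof -
  let ?P = "compile c e"
  have code: "code_at ?P 0 (code c 0 @ expr_code e)"
    by (simp add: compile_def code_at_def)
  then have c: "code_at ?P 0 (code c 0)" "code_at ?P (code_len c) (expr_code e)"
    by (simp_all add: code_at_append)
  have "rel init_state (\<lambda>_. 0)" by (simp add: rel_def init_state_def)
  from code_correct[OF assms(1) c(1) this, of xs] obtain r1 where
    1: "steps ?P xs (cost xs c init_state) (0, \<lambda>_. 0) (code_len c, r1)"
    and r1: "rel (run xs c init_state) r1" by auto
  from steps_expr[OF c(2) r1 assms(2), of xs] obtain r2 where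
    2: "steps ?P xs (length (expr_code e)) (code_len c, r1)
      (code_len c + length (expr_code e), r2)"
    and r2: "r2 0 = y" using assms(3) by metis
  let ?c = "(code_len c + length (expr_code e), r2)"
  have halt: "halted ?P ?c" by (simp add: halted_def compile_def)
  \<comment> \<open>A halted configuration no longer changes, so the exact step count can be
    replaced by any larger \<open>t\<close>.\<close>
  have "(ram_step ?P xs ^^ n) ?c = ?c" for n
    using halt by (induction n) (simp_all add: ram_step_def)
  then have "steps ?P xs (t - (cost xs c init_state + length (expr_code e))) ?c ?c"
    by (simp add: steps_def)
  from steps_trans[OF steps_trans[OF 1 2] this]
  have "steps ?P xs t (0, \<lambda>_. 0) ?c" using assms(4) by simp
  then show ?thesis
    using halt r2 by (simp add: ram_computes_within_def steps_def)
qed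

subsection \<open>Running times\<close>

primrec loop_bounds :: "com \<Rightarrow> nat set" where
  "loop_bounds Skip = {}"
| "loop_bounds (x ::= e) = {}"
| "loop_bounds (Put a x e) = {}"
| "loop_bounds (Scan x y) = {}"
| "loop_bounds (c1 ;; c2) = loop_bounds c1 \<union> loop_bounds c2"
| "loop_bounds (If e c1 c2) = loop_bounds c1 \<union> loop_bounds c2"
| "loop_bounds (For i n c) = insert n (loop_bounds c)"

primrec loop_depth :: "com \<Rightarrow> nat" where
  "loop_depth Skip = 0"
| "loop_depth (x ::= e) = 0"
| "loop_depth (Put a x e) = 0"
| "loop_depth (Scan x y) = 1"
| "loop_depth (c1 ;; c2) = max (loop_depth c1) (loop_depth c2)"
| "loop_depth (If e c1 c2) = max (loop_depth c1) (loop_depth c2)"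
| "loop_depth (For i n c) = Suc (loop_depth c)"

primrec cost_factor :: "com \<Rightarrow> nat" where
  "cost_factor Skip = 0"
| "cost_factor (x ::= e) = length (expr_code e) + 1"
| "cost_factor (Put a x e) = length (put_code a x e)"
| "cost_factor (Scan x y) = 16"
| "cost_factor (c1 ;; c2) = cost_factor c1 + cost_factor c2"
| "cost_factor (If e c1 c2) = length (expr_code e) + 2 + cost_factor c1 + cost_factor c2"
| "cost_factor (For i n c) = 12 + cost_factor c"

text \<open>As \<open>c\<close> assigns none of its loop bounds, they all keep their initial values,
  which are at most \<open>B\<close>; each nesting level then costs at most one factor
  \<open>B\<close>.\<close>

lemma cost_bound:
  assumes "loop_bounds c \<inter> mods c = {}" "wf_com c"
    and "\<And>x. x \<in> loop_bounds c \<Longrightarrow> fst s x \<le> B" "\<And>i. unary_at xs i \<le> B" "1 \<le> B"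
  shows "cost xs c s \<le> cost_factor c * B ^ loop_depth c"
  using assms(1-3)
proof (induction c arbitrary: s)
  case (Scan x y)
  have "9 * unary_at xs (fst s y) + 7 \<le> 9 * B + 7 * B"
    using assms(4)[of "fst s y"] \<open>1 \<le> B\<close> by (intro add_mono mult_le_mono) auto
  then show ?case by simp
next
  case (Seq c1 c2)
  have 1: "cost xs c1 s \<le> cost_factor c1 * B ^ loop_depth c1"
    using Seq(3-5) by (intro Seq(1)) auto
  have "fst (run xs c1 s) x \<le> B" if "x \<in> loop_bounds c2" for x
    using Seq(3,5) that by (subst run_mods) auto
  then have 2: "cost xs c2 (run xs c1 s) \<le> cost_factor c2 * B ^ loop_depth c2"
    using Seq(3,4) by (intro Seq(2)) auto
  have "B ^ loop_depth c1 \<le> B ^ max (loop_depth c1) (loop_depth c2)"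
    "B ^ loop_depth c2 \<le> B ^ max (loop_depth c1) (loop_depth c2)"
    using \<open>1 \<le> B\<close> by (auto intro: power_increasing)
  then show ?case using 1 2
    by (simp add: distrib_right) (meson add_mono le_trans mult_le_mono2)
next
  case (If e c1 c2)
  let ?D = "max (loop_depth c1) (loop_depth c2)"
  have 1: "cost xs c1 s \<le> cost_factor c1 * B ^ loop_depth c1"
    using If(3-5) by (intro If(1)) auto
  have 2: "cost xs c2 s \<le> cost_factor c2 * B ^ loop_depth c2"
    using If(3-5) by (intro If(2)) auto
  have "B ^ loop_depth c1 \<le> B ^ ?D" "B ^ loop_depth c2 \<le> B ^ ?D"
    using \<open>1 \<le> B\<close> by (auto intro: power_increasing)
  then have 3: "cost xs c1 s \<le> cost_factor c1 * B ^ ?D" "cost xs c2 s \<le> cost_factor c2 * B ^ ?D"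
    using 1 2 by (meson le_trans mult_le_mono2)+
  have "length (expr_code e) + 2 \<le> (length (expr_code e) + 2) * B ^ ?D"
    using one_le_power[OF \<open>1 \<le> B\<close>, of ?D] by (metis mult.right_neutral mult_le_mono2)
  then have "cost xs (If e c1 c2) s \<le> (length (expr_code e) + 2) * B ^ ?D +
      (cost_factor c1 * B ^ ?D + cost_factor c2 * B ^ ?D)"
    using 3 by (auto intro: order_trans[OF add_mono])
  then show ?case by (simp add: distrib_right)
next
  case (For i n c)
  let ?s = "\<lambda>k. (for_iter xs i c ^^ k) (setv i 0 s)"
  have i: "i \<notin> mods c" using For(3) by simp
  have "cost xs c (?s k) \<le> cost_factor c * B ^ loop_depth c" for k
  proof (rule For(1))
    fix x assume "x \<in> loop_bounds c"
    then have "fst (?s k) x = fst s x"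
      using For(2) by (intro agreeD(1)[OF for_iter_agree]) auto
    then show "fst (?s k) x \<le> B" using For(4) \<open>x \<in> loop_bounds c\<close> by simp
  qed (use For in auto)
  then have "(\<Sum>k<fst s n. 7 + cost xs c (?s k)) \<le>
      (\<Sum>k<fst s n. (7 + cost_factor c) * B ^ loop_depth c)"
    using \<open>1 \<le> B\<close> by (intro sum_mono) (simp add: distrib_right add_mono)
  also have "\<dots> \<le> B * ((7 + cost_factor c) * B ^ loop_depth c)"
    using For(4)[of n] by (simp add: mult_le_mono1)
  finally have "(\<Sum>k<fst s n. 7 + cost xs c (?s k)) \<le> (7 + cost_factor c) * B ^ loop_depth (For i n c)"
    by (simp add: mult_ac)
  moreover have "5 \<le> 5 * B ^ loop_depth (For i n c)" using \<open>1 \<le> B\<close> by simp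
  ultimately have "cost xs (For i n c) s \<le> 5 * B ^ loop_depth (For i n c) +
      (7 + cost_factor c) * B ^ loop_depth (For i n c)"
    unfolding cost_For by (rule add_mono[rotated])
  then show ?case by (simp add: distrib_right)
qed auto

section \<open>Counting by dynamic programming\<close>

fun horner :: "nat \<Rightarrow> (nat \<Rightarrow> nat) \<Rightarrow> nat \<Rightarrow> nat" where
  "horner q w 0 = 0"
| "horner q w (Suc n) = horner q w n * q + w n"

lemma horner_less:
  assumes "\<And>j. j < n \<Longrightarrow> w j < q"
  shows "horner q w n < q ^ n"
  using assms
proof (induction n)
  case (Suc n)
  have "horner q w n * q + w n < (horner q w n + 1) * q"
    using Suc.prems[of n] by simp
  also have "\<dots> \<le> q ^ n * q"
    using Suc by (intro mult_le_mono1) (simp add: Suc_le_eq)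
  finally show ?case by (simp add: mult.commute)
qed simp

text \<open>The digit entered first is the most significant one, so coordinate \<open>j\<close>
  belongs to the exponent \<open>n - 1 - j\<close>.\<close>

lemma horner_digit:
  assumes "\<And>j. j < n \<Longrightarrow> w j < q" "j < n"
  shows "horner q w n div q ^ (n - 1 - j) mod q = w j"
  using assms
proof (induction n)
  case (Suc n)
  show ?case
  proof (cases "j = n")
    case True
    then show ?thesis using Suc.prems(1)[of n] by simp
  next
    case False
    have "0 < q" using Suc.prems(1)[of n] by simp
    moreover have "Suc n - 1 - j = Suc (n - 1 - j)" using False Suc.prems(2) by simp
    ultimately have "horner q w (Suc n) div q ^ (Suc n - 1 - j) =
        horner q w n div q ^ (n - 1 - j)"
      using Suc.prems(1)[of n] by (simp add: div_mult2_eq)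
    then show ?thesis using Suc False by simp
  qed
qed simp

definition vest_count :: "('a, 'b) ring_scheme \<Rightarrow> 'a vest \<Rightarrow> 'a vec \<Rightarrow> nat \<Rightarrow> nat" where
  "vest_count F V w k = card {is. length is = k \<and> set is \<subseteq> {..<vest_m V} \<and>
     mult_mat_vec_over F (vest_S V) (fold (\<lambda>i w. mult_mat_vec_over F (vest_T V ! i) w) is w) =
     vec (vest_h V) (\<lambda>_. \<zero>\<^bsub>F\<^esub>)}"

lemma vest_M_eq: "vest_M F V k = vest_count F V (vest_v V) k"
  by (simp add: vest_M_def vest_count_def vest_eval_def)

lemma vest_count_0:
  "vest_count F V w 0 =
     (if mult_mat_vec_over F (vest_S V) w = vec (vest_h V) (\<lambda>_. \<zero>\<^bsub>F\<^esub>) then 1 else 0)"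
proof -
  have "{is. length is = 0 \<and> set is \<subseteq> {..<vest_m V} \<and> Q is} = (if Q [] then {[]} else {})" for Q
    by auto
  then show ?thesis by (simp add: vest_count_def)
qed

text \<open>A sequence is split at its first index, whose matrix is applied first; its tail is then
  counted from the image of \<open>w\<close>. Sequences with different first indices are different,
  so the counts add up.\<close>

lemma vest_count_Suc:
  "vest_count F V w (Suc k) =
     (\<Sum>i<vest_m V. vest_count F V (mult_mat_vec_over F (vest_T V ! i) w) k)"
proof -
  let ?Q = "\<lambda>w is. mult_mat_vec_over F (vest_S V)
    (fold (\<lambda>i w. mult_mat_vec_over F (vest_T V ! i) w) is w) = vec (vest_h V) (\<lambda>_. \<zero>\<^bsub>F\<^esub>)"
  let ?A = "\<lambda>w k. {is. length is = k \<and> set is \<subseteq> {..<vest_m V} \<and> ?Q w is}"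
  let ?T = "\<lambda>i. mult_mat_vec_over F (vest_T V ! i) w"
  have "?A w (Suc k) = (\<Union>i<vest_m V. (#) i ` ?A (?T i) k)"
  proof (intro equalityI subsetI)
    fix js assume "js \<in> ?A w (Suc k)"
    then show "js \<in> (\<Union>i<vest_m V. (#) i ` ?A (?T i) k)" by (cases js) auto
  qed auto
  moreover have "finite (?A w k)" for w
    by (rule finite_subset[OF _ finite_lists_length_eq[of "{..<vest_m V}" k]]) auto
  ultimately have "card (?A w (Suc k)) = (\<Sum>i<vest_m V. card ((#) i ` ?A (?T i) k))"
    by (simp only:) (intro card_UN_disjoint, auto)
  also have "\<dots> = (\<Sum>i<vest_m V. card (?A (?T i) k))"
    by (intro sum.cong refl card_image) simp
  finally show ?thesis by (simp add: vest_count_def)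
qed

section \<open>The recursion on numbers of vectors\<close>

locale low_rank_vest =
  fixes F :: "nat ring" and p :: nat and V :: "nat vest"
  assumes presentation: "finite_field_presentation F"
    and vest_inst: "vest_instance F V"
    and rows_zero: "rows_zero_from F p V"
begin

abbreviation "q \<equiv> card (carrier F)"
abbreviation "d \<equiv> vest_d V"
abbreviation "m \<equiv> vest_m V"
abbreviation "h \<equiv> vest_h V"

definition rank :: nat where "rank = min p d"
definition N :: nat where "N = q ^ rank"

lemma field: "field F"
  using presentation by (simp add: finite_field_presentation_def)

sublocale field F by (rule field)

lemma carrier_eq: "carrier F = {..<q}"
  using presentation by (simp add: finite_field_presentation_def)

lemma in_carrier_iff: "a \<in> carrier F \<longleftrightarrow> a < q"
  by (subst carrier_eq) simp

lemma zero_less: "\<zero>\<^bsub>F\<^esub> < q"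
  using zero_closed in_carrier_iff by simp

definition dot :: "(nat \<Rightarrow> nat) \<Rightarrow> (nat \<Rightarrow> nat) \<Rightarrow> nat" where
  "dot a w = (\<Oplus>\<^bsub>F\<^esub>j\<in>{..<d}. a j \<otimes>\<^bsub>F\<^esub> w j)"

lemma dot_less: "(\<And>j. j < d \<Longrightarrow> a j < q) \<Longrightarrow> (\<And>j. j < d \<Longrightarrow> w j < q) \<Longrightarrow> dot a w < q"
  unfolding dot_def in_carrier_iff[symmetric] by (intro finsum_closed) auto

lemma T_entry: "i < m \<Longrightarrow> r < d \<Longrightarrow> j < d \<Longrightarrow> vest_T V ! i $$ (r, j) < q"
  and T_dim: "i < m \<Longrightarrow> vest_T V ! i \<in> carrier_mat d d"
proof -
  assume "i < m"
  then have i: "vest_T V ! i \<in> set (vest_T V)" using vest_inst by (simp add: vest_instance_def)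
  then show dim: "vest_T V ! i \<in> carrier_mat d d" using vest_inst by (simp add: vest_instance_def)
  assume "r < d" "j < d"
  then have "vest_T V ! i $$ (r, j) \<in> elements_mat (vest_T V ! i)"
    using dim by (intro elements_matI) auto
  then show "vest_T V ! i $$ (r, j) < q"
    using i vest_inst by (auto simp: vest_instance_def simp flip: in_carrier_iff)
qed

lemma S_dim: "vest_S V \<in> carrier_mat h d"
  using vest_inst by (simp add: vest_instance_def)

lemma S_entry: "r < h \<Longrightarrow> j < d \<Longrightarrow> vest_S V $$ (r, j) < q"
proof -
  assume "r < h" "j < d"
  then have "vest_S V $$ (r, j) \<in> elements_mat (vest_S V)"
    using S_dim by (intro elements_matI) auto
  then show ?thesis
    using vest_inst by (auto simp: vest_instance_def simp flip: in_carrier_iff)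
qed

lemma v_entry: "j < d \<Longrightarrow> vest_v V $ j < q"
  using vest_inst by (simp add: vest_instance_def flip: in_carrier_iff)

lemma mult_mat_vec_eq:
  assumes "A \<in> carrier_mat n d"
  shows "mult_mat_vec_over F A w = vec n (\<lambda>r. dot (\<lambda>j. A $$ (r, j)) (($) w))"
  using assms by (auto simp: mult_mat_vec_over_def dot_def)

text \<open>
  After the first step only the first \<open>rank\<close> coordinates can be nonzero; such vectors are numbered
  by reading these coordinates as the digits of a number below \<open>N\<close>. The number \<open>N\<close> itself stands
  for the initial vector, which need not be of this form.
\<close>

definition dec :: "nat \<Rightarrow> nat \<Rightarrow> nat" where
  "dec x j = (if N \<le> x then vest_v V $ j
     else if j < rank then x div q ^ (rank - 1 - j) mod q else \<zero>\<^bsub>F\<^esub>)"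

text \<open>Only the first \<open>rank\<close> entries of the image are encoded, because the others
  vanish by \<open>dot_T_zero\<close>.\<close>

definition succ_state :: "nat \<Rightarrow> nat \<Rightarrow> nat" where
  "succ_state i x = horner q (\<lambda>r. dot (\<lambda>j. vest_T V ! i $$ (r, j)) (dec x)) rank"

fun table :: "nat \<Rightarrow> nat \<Rightarrow> nat" where
  "table 0 x = (if \<forall>r<h. dot (\<lambda>j. vest_S V $$ (r, j)) (dec x) = \<zero>\<^bsub>F\<^esub> then 1 else 0)"
| "table (Suc t) x = (\<Sum>i<m. table t (succ_state i x))"

lemma dec_less: "j < d \<Longrightarrow> dec x j < q"
  using v_entry zero_less by (auto simp: dec_def)

lemma dot_dec:
  assumes "\<And>j. j < d \<Longrightarrow> a j < q"
  shows "dot a (($) (vec d (dec x))) = dot a (dec x)"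
  unfolding dot_def using assms dec_less in_carrier_iff m_closed
  by (intro finsum_cong) (auto simp: simp_implies_def)

lemma dot_T_less: "i < m \<Longrightarrow> r < d \<Longrightarrow> dot (\<lambda>j. vest_T V ! i $$ (r, j)) (dec x) < q"
  by (intro dot_less dec_less T_entry)

lemma succ_state_less: "i < m \<Longrightarrow> succ_state i x < N"
  unfolding succ_state_def N_def by (intro horner_less dot_T_less) (auto simp: rank_def)

lemma dot_T_zero:
  assumes "i < m" "rank \<le> r" "r < d"
  shows "dot (\<lambda>j. vest_T V ! i $$ (r, j)) (dec x) = \<zero>\<^bsub>F\<^esub>"
proof -
  \<comment> \<open>From \<open>rank \<le> r\<close> and \<open>r < d\<close> it follows that
    \<open>rank\<close> is \<open>p\<close>, so \<open>r\<close> is one of the zero rows.\<close>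
  have "vest_T V ! i $$ (r, j) = \<zero>\<^bsub>F\<^esub>" if "j < d" for j
    using assms that rows_zero vest_inst
    by (auto simp: rows_zero_from_def vest_instance_def rank_def)
  then have "dot (\<lambda>j. vest_T V ! i $$ (r, j)) (dec x) = (\<Oplus>\<^bsub>F\<^esub>j\<in>{..<d}. \<zero>\<^bsub>F\<^esub>)"
    unfolding dot_def using dec_less in_carrier_iff zero_less by (intro finsum_cong) auto
  then show ?thesis by simp
qed

lemma mult_T_dec:
  assumes "i < m"
  shows "mult_mat_vec_over F (vest_T V ! i) (vec d (dec x)) = vec d (dec (succ_state i x))"
proof (rule eq_vecI)
  fix r assume "r < dim_vec (vec d (dec (succ_state i x)))"
  then have r: "r < d" by simp
  have *: "\<not> N \<le> succ_state i x" using succ_state_less[OF assms] by (simp add: not_le)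
  have "dot (\<lambda>j. vest_T V ! i $$ (r, j)) (dec x) = dec (succ_state i x) r"
  proof (cases "r < rank")
    case True
    then have "dec (succ_state i x) r = succ_state i x div q ^ (rank - 1 - r) mod q"
      using * by (simp add: dec_def)
    also have "\<dots> = dot (\<lambda>j. vest_T V ! i $$ (r, j)) (dec x)"
      unfolding succ_state_def using True assms
      by (intro horner_digit dot_T_less) (auto simp: rank_def)
    finally show ?thesis by simp
  next
    case False
    then show ?thesis using * r dot_T_zero[OF assms, of r x] by (simp add: dec_def)
  qed
  then show "mult_mat_vec_over F (vest_T V ! i) (vec d (dec x)) $ r =
      vec d (dec (succ_state i x)) $ r"
    using r assms by (simp add: mult_mat_vec_eq[OF T_dim[OF assms]] dot_dec T_entry)
qed (use T_dim[OF assms] in \<open>simp add: mult_mat_vec_over_def\<close>)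

text \<open>\<open>mult_T_dec\<close> turns the recursion on vectors into one on their numbers;
  \<open>x\<close> is arbitrary in the induction because the recursion moves to the successors of
  \<open>x\<close>.\<close>

lemma vest_count_dec: "vest_count F V (vec d (dec x)) k = table k x"
proof (induction k arbitrary: x)
  case 0
  show ?case
    by (auto simp: vest_count_0 mult_mat_vec_eq[OF S_dim] dot_dec S_entry vec_eq_iff)
next
  case (Suc k)
  then show ?case by (simp add: vest_count_Suc mult_T_dec)
qed

lemma vest_M_table: "vest_M F V k = table k N"
proof -
  have "vest_v V = vec d (dec N)"
    using vest_inst by (auto simp: dec_def vest_instance_def)
  then show ?thesis by (simp add: vest_M_eq vest_count_dec)
qed

end

subsection \<open>Reading the input\<close>

text \<open>Row-major addressing, for the operation tables, the rows of a matrix and the list of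
  matrices.\<close>

lemma concat_uniform:
  assumes "\<And>ys. ys \<in> set yss \<Longrightarrow> length ys = n"
  shows "length (concat yss) = length yss * n"
    and "i < length yss \<Longrightarrow> j < n \<Longrightarrow> concat yss ! (i * n + j) = yss ! i ! j"
proof -
  show "length (concat yss) = length yss * n"
    using assms by (induction yss) auto
  show "i < length yss \<Longrightarrow> j < n \<Longrightarrow> concat yss ! (i * n + j) = yss ! i ! j"
    using assms
  proof (induction yss arbitrary: i)
    case (Cons ys yss)
    then show ?case by (cases i) (auto simp: nth_append)
  qed simp
qed

lemma rd_append:
  "l = length as \<Longrightarrow> i < length bs \<Longrightarrow> rd (as @ bs @ cs) (l + i) = bs ! i"
  by (simp add: rd_def nth_append)

lemma unary_at_le: "unary_at xs i \<le> length xs"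
  unfolding unary_at_def by (rule Least_le) (simp add: rd_def)

lemma length_le_input_size: "length xs \<le> input_size xs"
proof -
  have "length xs = (\<Sum>x\<leftarrow>xs. 1)" by (simp add: sum_list_triv)
  also have "\<dots> \<le> input_size xs" unfolding input_size_def by (intro sum_list_mono) simp
  finally show ?thesis .
qed

locale low_rank_vest_input = low_rank_vest +
  fixes k :: nat and xs :: "nat list"
  assumes xs_def: "xs = encode_input (F, p, V, k)"
begin

text \<open>Start positions of the blocks of the input. Three numbers and the addition table precede
  the multiplication table, and \<open>head_pos\<close> is the position of \<open>p\<close>. The
  products are written in the order in which the program forms them.\<close>

definition mul_pos :: nat where "mul_pos = q * q + 3"
definition head_pos :: nat where "head_pos = mul_pos + q * q"
definition v_pos :: nat where "v_pos = head_pos + 4"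
definition T_pos :: nat where "T_pos = v_pos + d"
definition S_pos :: nat where "S_pos = T_pos + d * d * m"
definition k_pos :: nat where "k_pos = S_pos + d * h"

lemma length_field: "length (encode_field F) = head_pos"
  unfolding encode_field_def Let_def head_pos_def mul_pos_def
  by (simp add: length_concat comp_def sum_list_triv)

lemma
  shows rd_q: "rd xs 0 = q" and rd_zero: "rd xs 1 = \<zero>\<^bsub>F\<^esub>"
  unfolding xs_def by (simp_all add: rd_def encode_field_def Let_def)

text \<open>The index is arranged like the expression that the program evaluates, so that the
  equation can be used for rewriting; the same holds for \<open>rd_mul\<close>, \<open>rd_T\<close>
  and \<open>rd_S\<close>.\<close>

lemma rd_add:
  assumes "a < q" "b < q"
  shows "rd xs (a * q + b + 3) = a \<oplus>\<^bsub>F\<^esub> b"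
proof -
  let ?t = "concat (map (\<lambda>a. map (\<lambda>b. a \<oplus>\<^bsub>F\<^esub> b) [0..<q]) [0..<q])"
  obtain cs where xs: "xs = [q, \<zero>\<^bsub>F\<^esub>, \<one>\<^bsub>F\<^esub>] @ ?t @ cs"
    unfolding xs_def encode_input.simps encode_field_def Let_def append_assoc by blast
  have t: "length ?t = q * q" by (subst concat_uniform(1)[where n = q]) auto
  have "a * q + b < (a + 1) * q" using assms by simp
  also have "\<dots> \<le> q * q" using assms by (intro mult_le_mono1) simp
  finally have "rd xs (3 + (a * q + b)) = ?t ! (a * q + b)"
    unfolding xs by (intro rd_append) (simp_all add: t)
  also have "\<dots> = a \<oplus>\<^bsub>F\<^esub> b"
    using assms by (subst concat_uniform(2)[where n = q]) auto
  finally show ?thesis by (simp add: add.commute)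
qed

lemma rd_mul:
  assumes "a < q" "b < q"
  shows "rd xs (b + a * q + mul_pos) = a \<otimes>\<^bsub>F\<^esub> b"
proof -
  let ?s = "concat (map (\<lambda>a. map (\<lambda>b. a \<oplus>\<^bsub>F\<^esub> b) [0..<q]) [0..<q])"
  let ?t = "concat (map (\<lambda>a. map (\<lambda>b. a \<otimes>\<^bsub>F\<^esub> b) [0..<q]) [0..<q])"
  obtain cs where xs: "xs = ([q, \<zero>\<^bsub>F\<^esub>, \<one>\<^bsub>F\<^esub>] @ ?s) @ ?t @ cs"
    unfolding xs_def encode_input.simps encode_field_def Let_def append_assoc by blast
  have s: "length ?s = q * q" by (subst concat_uniform(1)[where n = q]) auto
  have t: "length ?t = q * q" by (subst concat_uniform(1)[where n = q]) auto
  have "a * q + b < (a + 1) * q" using assms by simp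
  also have "\<dots> \<le> q * q" using assms by (intro mult_le_mono1) simp
  finally have "rd xs (mul_pos + (a * q + b)) = ?t ! (a * q + b)"
    unfolding xs by (intro rd_append) (simp_all add: s t mul_pos_def)
  also have "\<dots> = a \<otimes>\<^bsub>F\<^esub> b"
    using assms by (subst concat_uniform(2)[where n = q]) auto
  finally show ?thesis by (simp add: add_ac)
qed

lemma rd_head:
  shows "rd xs head_pos = p" "rd xs (head_pos + 1) = d" "rd xs (head_pos + 2) = m"
    "rd xs (head_pos + 3) = h"
proof -
  obtain cs where xs: "xs = encode_field F @ [p, d, m, h] @ cs"
    unfolding xs_def encode_input.simps encode_vest_def by simp
  have rd: "rd xs (head_pos + i) = [p, d, m, h] ! i" if "i < 4" for i
    unfolding xs using that length_field by (intro rd_append) auto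
  from rd[of 0] rd[of 1] rd[of 2] rd[of 3]
  show "rd xs head_pos = p" "rd xs (head_pos + 1) = d" "rd xs (head_pos + 2) = m"
    "rd xs (head_pos + 3) = h" by simp_all
qed

abbreviation "T_list \<equiv> concat (map (\<lambda>A. concat (mat_to_list A)) (vest_T V))"
abbreviation "S_list \<equiv> concat (mat_to_list (vest_S V))"

lemma xs_eq: "xs = (encode_field F @ [p, d, m, h]) @ list_of_vec (vest_v V) @
    T_list @ S_list @ replicate k 1 @ [0]"
  unfolding xs_def encode_input.simps encode_vest_def encode_unary_def by simp

lemma concat_mat:
  assumes "A \<in> carrier_mat n d"
  shows "length (concat (mat_to_list A)) = n * d"
    and "r < n \<Longrightarrow> j < d \<Longrightarrow> concat (mat_to_list A) ! (r * d + j) = A $$ (r, j)"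
proof -
  have "length ys = d" if "ys \<in> set (mat_to_list A)" for ys
    using that assms by (auto simp: mat_to_list_def)
  note uniform = concat_uniform[of "mat_to_list A", OF this]
  show "length (concat (mat_to_list A)) = n * d"
    and "r < n \<Longrightarrow> j < d \<Longrightarrow> concat (mat_to_list A) ! (r * d + j) = A $$ (r, j)"
    using assms uniform by (auto simp: mat_to_list_def)
qed

lemma length_v: "length (list_of_vec (vest_v V)) = d"
  using vest_inst by (simp add: vest_instance_def)

lemma length_T: "length (vest_T V) = m"
  using vest_inst by (simp add: vest_instance_def)

lemma T_list_uniform: "ys \<in> set (map (\<lambda>A. concat (mat_to_list A)) (vest_T V)) \<Longrightarrow> length ys = d * d"
  using vest_inst concat_mat(1) by (auto simp: vest_instance_def)

lemma length_T_list: "length T_list = m * (d * d)"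
  by (subst concat_uniform(1)[OF T_list_uniform]) (simp_all add: length_T)

lemma length_S_list: "length S_list = h * d"
  using concat_mat(1)[OF S_dim] .

lemma rd_v: "j < d \<Longrightarrow> rd xs (v_pos + j) = vest_v V $ j"
  unfolding xs_eq using length_field length_v
  by (subst rd_append) (auto simp: v_pos_def list_of_vec_index)

lemma index_less: "i < a \<Longrightarrow> j < b \<Longrightarrow> i * b + j < a * (b::nat)"
proof -
  assume "i < a" "j < b"
  then have "i * b + j < (i + 1) * b" by simp
  also have "\<dots> \<le> a * b" using \<open>i < a\<close> by (intro mult_le_mono1) simp
  finally show ?thesis .
qed

lemma rd_T:
  assumes "i < m" "r < d" "j < d"
  shows "rd xs ((i * d + r) * d + T_pos + j) = vest_T V ! i $$ (r, j)"
proof -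
  have rj: "r * d + j < d * d" using assms by (intro index_less)
  then have irj: "i * (d * d) + (r * d + j) < m * (d * d)" using assms by (intro index_less)
  have "xs = ((encode_field F @ [p, d, m, h]) @ list_of_vec (vest_v V)) @ T_list @
      S_list @ replicate k 1 @ [0]" by (simp add: xs_eq)
  then have "rd xs (T_pos + (i * (d * d) + (r * d + j))) = T_list ! (i * (d * d) + (r * d + j))"
    using irj length_field length_v length_T_list
    by (simp only:) (intro rd_append, auto simp: T_pos_def v_pos_def)
  also have "\<dots> = vest_T V ! i $$ (r, j)"
    using assms rj length_T T_dim[of i]
    by (subst concat_uniform(2)[OF T_list_uniform]) (auto simp: concat_mat(2))
  finally show ?thesis by (simp add: algebra_simps)
qed

lemma rd_S:
  assumes "r < h" "j < d"
  shows "rd xs (r * d + S_pos + j) = vest_S V $$ (r, j)"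
proof -
  have rj: "r * d + j < h * d" using assms by (intro index_less)
  have "xs = ((encode_field F @ [p, d, m, h]) @ list_of_vec (vest_v V) @ T_list) @
      S_list @ replicate k 1 @ [0]" by (simp add: xs_eq)
  then have "rd xs (S_pos + (r * d + j)) = S_list ! (r * d + j)"
    using rj length_field length_v length_T_list length_S_list
    by (simp only:) (intro rd_append, auto simp: S_pos_def T_pos_def v_pos_def)
  also have "\<dots> = vest_S V $$ (r, j)"
    using assms by (intro concat_mat(2)[OF S_dim])
  finally show ?thesis by (simp add: algebra_simps)
qed

lemma unary_at_k: "unary_at xs k_pos = k"
proof -
  let ?as = "(encode_field F @ [p, d, m, h]) @ list_of_vec (vest_v V) @ T_list @ S_list"
  have "xs = ?as @ (replicate k 1 @ [0]) @ []" by (simp add: xs_eq)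
  moreover have "k_pos = length ?as"
    using length_field length_v length_T_list length_S_list
    by (simp add: k_pos_def S_pos_def T_pos_def v_pos_def)
  ultimately have rd: "rd xs (k_pos + i) = (replicate k 1 @ [0]) ! i" if "i < k + 1" for i
    using that by (simp only:) (intro rd_append, auto)
  show ?thesis unfolding unary_at_def
  proof (rule Least_equality)
    show "rd xs (k_pos + k) = 0" using rd[of k] by (simp add: nth_append)
    show "k \<le> i" if "rd xs (k_pos + i) = 0" for i
      using rd[of i] that by (cases "i < k") (auto simp: nth_append)
  qed
qed

text \<open>The 8 counts the three numbers before the operation tables, the four numbers
  \<open>p\<close>, \<open>d\<close>, \<open>m\<close>, \<open>h\<close>, and the 0 that ends the
  unary number.\<close>

lemma length_xs: "length xs = 8 + 2 * (q * q) + d + m * (d * d) + h * d + k"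
  using length_field length_v length_T_list length_S_list
  by (simp add: xs_eq head_pos_def mul_pos_def)

end

section \<open>The program\<close>

text \<open>
  Arrays 0 and 1 hold the old and the new table, indexed by states, and array 2 the vector that
  is being processed. Variables up to \<open>x_S\<close> are constants computed from the input, and
  \<open>x_mul\<close>, \<open>x_v\<close>, \<open>x_T\<close>, \<open>x_S\<close> are positions in the input.
\<close>

abbreviation (input) "x_q \<equiv> 2::nat"
abbreviation (input) "x_zero \<equiv> 3::nat"
abbreviation (input) "x_p \<equiv> 4::nat"
abbreviation (input) "x_d \<equiv> 5::nat"
abbreviation (input) "x_m \<equiv> 6::nat"
abbreviation (input) "x_h \<equiv> 7::nat"
abbreviation (input) "x_rank \<equiv> 8::nat"
abbreviation (input) "x_N \<equiv> 9::nat"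
abbreviation (input) "x_N1 \<equiv> 10::nat"
abbreviation (input) "x_k \<equiv> 11::nat"
abbreviation (input) "x_mul \<equiv> 12::nat"
abbreviation (input) "x_v \<equiv> 13::nat"
abbreviation (input) "x_T \<equiv> 14::nat"
abbreviation (input) "x_S \<equiv> 15::nat"
abbreviation (input) "x_o \<equiv> 16::nat"
abbreviation (input) "x_acc \<equiv> 17::nat"
abbreviation (input) "x_a \<equiv> 18::nat"
abbreviation (input) "x_b \<equiv> 19::nat"
abbreviation (input) "x_j \<equiv> 20::nat"
abbreviation (input) "x_c \<equiv> 21::nat"
abbreviation (input) "x_i \<equiv> 22::nat"
abbreviation (input) "x_r \<equiv> 23::nat"
abbreviation (input) "x_y \<equiv> 24::nat"
abbreviation (input) "x_x \<equiv> 25::nat"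
abbreviation (input) "x_quo \<equiv> 26::nat"
abbreviation (input) "x_flag \<equiv> 27::nat"
abbreviation (input) "x_sum \<equiv> 28::nat"
abbreviation (input) "x_t \<equiv> 29::nat"

abbreviation (input) "Var x \<equiv> At (Vr x)"
abbreviation (input) "Num n \<equiv> At (Cn n)"

text \<open>The time grows with the second factor, for which the algorithm only uses q, d, m and h.
  As \<open>z\<close> is reset first, it must differ from both factors; \<open>pow_com\<close>
  therefore multiplies into an auxiliary variable.\<close>

definition mul_com :: "nat \<Rightarrow> nat \<Rightarrow> nat \<Rightarrow> com" where
  "mul_com z x y = z ::= Num 0 ;; For x_c y (z ::= Plus (Var z) (Vr x))"

definition pow_com :: com where
  "pow_com = x_N ::= Num 1 ;; For x_r x_rank (mul_com x_a x_N x_q ;; x_N ::= Var x_a)"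

text \<open>The row starts at input position \<open>x_o\<close> and the vector is in array 2, so the
  same code serves the rows of the \<open>T_i\<close> and of \<open>S\<close>. Field operations are
  look-ups in the tables, at offset a q + b for the operands a and b.\<close>

definition dot_com :: com where
  "dot_com = x_acc ::= Var x_zero ;;
     For x_j x_d
      (x_a ::= Inp (Plus (Var x_o) (Vr x_j)) ;;
       mul_com x_b x_a x_q ;;
       x_a ::= Inp (Plus (Plus (Get 2 (Var x_j)) (Vr x_b)) (Vr x_mul)) ;;
       mul_com x_b x_a x_q ;;
       x_acc ::= Inp (Plus (Plus (Var x_b) (Vr x_acc)) (Cn 3)))"

definition T_row_com :: com where
  "T_row_com =
     mul_com x_a x_i x_d ;;
     x_a ::= Plus (Var x_a) (Vr x_r) ;;
     mul_com x_o x_a x_d ;;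
     x_o ::= Plus (Var x_o) (Vr x_T)"

text \<open>The number of the image is accumulated digit by digit and the image is never stored, so
  array 2 keeps the current vector for the next matrix.\<close>

definition succ_com :: com where
  "succ_com = x_y ::= Num 0 ;;
     For x_r x_rank
      (T_row_com ;;
       dot_com ;;
       mul_com x_a x_y x_q ;;
       x_y ::= Plus (Var x_a) (Vr x_acc))"

text \<open>Repeated subtraction as a counted loop: the test is positive iff q \<le> y,
  \<open>N\<close> rounds suffice for y < \<open>N\<close>, and surplus rounds do nothing.\<close>

definition divmod_com :: com where
  "divmod_com = x_quo ::= Num 0 ;;
     For x_j x_N
      (If (Minus (Plus (Var x_y) (Cn 1)) (Vr x_q))
         (x_y ::= Minus (Var x_y) (Vr x_q) ;; x_quo ::= Plus (Var x_quo) (Cn 1))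
         Skip)"

text \<open>Digits come out least significant first and are therefore stored from coordinate
  \<open>rank - 1\<close> downwards. The outer test is positive iff x < \<open>N\<close>; otherwise
  v is loaded.\<close>

definition dec_com :: com where
  "dec_com =
     If (Minus (Var x_N) (Vr x_x))
      (For x_j x_d (Put 2 x_j (Var x_zero)) ;;
       x_y ::= Var x_x ;;
       For x_r x_rank
        (divmod_com ;;
         x_a ::= Minus (Minus (Var x_rank) (Cn 1)) (Vr x_r) ;;
         Put 2 x_a (Var x_y) ;;
         x_y ::= Var x_quo))
      (For x_j x_d (Put 2 x_j (Inp (Plus (Var x_v) (Vr x_j)))))"

definition S_row_com :: com where
  "S_row_com = mul_com x_o x_r x_d ;; x_o ::= Plus (Var x_o) (Vr x_S)"

text \<open>The zero of the field may carry any label, so equality with it is tested by cut-off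
  subtraction in both directions.\<close>

definition test_com :: com where
  "test_com = x_flag ::= Num 1 ;;
     For x_r x_h
      (S_row_com ;;
       dot_com ;;
       If (Minus (Var x_acc) (Vr x_zero)) (x_flag ::= Num 0) Skip ;;
       If (Minus (Var x_zero) (Vr x_acc)) (x_flag ::= Num 0) Skip)"

definition init_com :: com where
  "init_com = For x_x x_N1 (dec_com ;; test_com ;; Put 0 x_x (Var x_flag))"

definition sum_com :: com where
  "sum_com = x_sum ::= Num 0 ;;
     For x_i x_m (succ_com ;; x_sum ::= Plus (Get 0 (Var x_y)) (Vr x_sum))"

text \<open>The new table is copied back only when complete, since each of its entries may need any
  of the old ones.\<close>

definition step_com :: com where
  "step_com =
     For x_x x_N1 (dec_com ;; sum_com ;; Put 1 x_x (Var x_sum)) ;;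
     For x_x x_N1 (Put 0 x_x (Get 1 (Var x_x)))"

definition main_com :: com where
  "main_com = init_com ;; For x_t x_k step_com"

text \<open>The setup is cut so that every phase takes its loop bounds from earlier phases:
  \<open>x_q\<close> for the second, also \<open>x_d\<close>, \<open>x_m\<close>, \<open>x_h\<close>
  and \<open>x_rank\<close> for the third, and \<open>x_N\<close>, \<open>x_N1\<close> and
  \<open>x_k\<close> for the main part.\<close>

definition setup1_com :: com where
  "setup1_com = x_q ::= Inp (Num 0) ;; x_zero ::= Inp (Num 1)"

text \<open>\<open>x_rank\<close> becomes p - (p - d), which is min(p, d) for cut-off
  subtraction.\<close>

definition setup2_com :: com where
  "setup2_com =
     mul_com x_a x_q x_q ;;
     x_mul ::= Plus (Var x_a) (Cn 3) ;;
     x_o ::= Plus (Var x_mul) (Vr x_a) ;;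
     x_p ::= Inp (Var x_o) ;;
     x_d ::= Inp (Plus (Var x_o) (Cn 1)) ;;
     x_m ::= Inp (Plus (Var x_o) (Cn 2)) ;;
     x_h ::= Inp (Plus (Var x_o) (Cn 3)) ;;
     x_a ::= Minus (Var x_p) (Vr x_d) ;;
     x_rank ::= Minus (Var x_p) (Vr x_a) ;;
     x_v ::= Plus (Var x_o) (Cn 4) ;;
     x_T ::= Plus (Var x_v) (Vr x_d)"

definition setup3_com :: com where
  "setup3_com =
     mul_com x_a x_d x_d ;;
     mul_com x_b x_a x_m ;;
     x_S ::= Plus (Var x_T) (Vr x_b) ;;
     mul_com x_a x_d x_h ;;
     x_y ::= Plus (Var x_S) (Vr x_a) ;;
     Scan x_k x_y ;;
     pow_com ;;
     x_N1 ::= Plus (Var x_N) (Cn 1)"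

definition vest_com :: com where
  "vest_com = setup1_com ;; setup2_com ;; setup3_com ;; main_com"

section \<open>Frames and well-formedness of the subprograms\<close>

lemma mods_mul_com [simp]: "mods (mul_com z x y) = {z, x_c}" "mods_arr (mul_com z x y) = {}"
  by (auto simp: mul_com_def)

lemma mods_pow_com [simp]: "mods pow_com = {x_N, x_r, x_a, x_c}"
  by (auto simp: pow_com_def)

lemma mods_dot_com [simp]:
  "mods dot_com = {x_acc, x_j, x_a, x_b, x_c}" "mods_arr dot_com = {}"
  by (auto simp: dot_com_def)

lemma mods_succ_com [simp]:
  "mods succ_com = {x_y, x_r, x_o, x_acc, x_j, x_a, x_b, x_c}" "mods_arr succ_com = {}"
  by (auto simp: succ_com_def T_row_com_def)

lemma mods_divmod_com [simp]:
  "mods divmod_com = {x_quo, x_j, x_y}" "mods_arr divmod_com = {}"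
  by (auto simp: divmod_com_def)

lemma mods_dec_com [simp]:
  "mods dec_com = {x_quo, x_j, x_y, x_r, x_a}" "mods_arr dec_com = {2}"
  by (auto simp: dec_com_def)

lemma mods_test_com [simp]:
  "mods test_com = {x_flag, x_r, x_o, x_acc, x_j, x_a, x_b, x_c}" "mods_arr test_com = {}"
  by (auto simp: test_com_def S_row_com_def)

lemma mods_sum_com [simp]:
  "mods sum_com = {x_sum, x_i, x_y, x_r, x_o, x_acc, x_j, x_a, x_b, x_c}" "mods_arr sum_com = {}"
  by (auto simp: sum_com_def)

lemma wf_mul_com [simp]:
  "wf_com (mul_com z x y) \<longleftrightarrow> y \<noteq> x_c \<and> y \<noteq> z \<and> z \<noteq> x_c"
  by (auto simp: mul_com_def)

lemma wf_dot_com [simp]: "wf_com dot_com"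
  by (simp add: dot_com_def)

lemma wf_succ_com [simp]: "wf_com succ_com"
  by (simp add: succ_com_def T_row_com_def)

lemma wf_dec_com [simp]: "wf_com dec_com"
  by (simp add: dec_com_def) (simp add: divmod_com_def)

lemma wf_test_com [simp]: "wf_com test_com"
  by (simp add: test_com_def S_row_com_def)

lemma wf_sum_com [simp]: "wf_com sum_com"
  by (simp add: sum_com_def)

lemma wf_vest_com: "wf_com vest_com"
  by (simp add: vest_com_def setup1_com_def setup2_com_def setup3_com_def pow_com_def main_com_def
      init_com_def step_com_def)

section \<open>Correctness of the subprograms\<close>

lemma run_mul_com:
  assumes "z \<noteq> x" "z \<noteq> y" "x_c \<noteq> x" "x_c \<noteq> y" "x_c \<noteq> z"
  shows "fst (run xs (mul_com z x y) s) z = fst s x * fst s y"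
proof -
  let ?s = "setv z 0 s"
  let ?c = "z ::= Plus (Var z) (Vr x)"
  have "fst (run xs (For x_c y ?c) ?s) z = fst s x * fst ?s y"
  proof (rule For_rule[where I = "\<lambda>n s'. fst s' z = fst s x * n"])
    fix n s' assume "agree (For x_c y ?c) ?s s'" "fst s' z = fst s x * n"
    moreover from this have "fst s' x = fst s x"
      using assms agreeD(1)[of _ ?s s' x] by auto
    ultimately show "fst (setv x_c (Suc n) (run xs ?c s')) z = fst s x * Suc n"
      using assms by simp
  qed (use assms in auto)
  \<comment> \<open>The equation for \<open>For\<close> is withheld, so that the loop keeps the form
    in which the invariant rule speaks of it.\<close>
  then show ?thesis using assms by (simp add: mul_com_def del: run.simps(7))
qed

lemma run_mul_com_frame [simp]:
  "w \<noteq> z \<Longrightarrow> w \<noteq> x_c \<Longrightarrow> fst (run xs (mul_com z x y) s) w = fst s w"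
  "snd (run xs (mul_com z x y) s) = snd s"
  by (auto simp: run_mods run_mods_arr)

lemma run_pow_com: "fst (run xs pow_com s) x_N = fst s x_q ^ fst s x_rank"
proof -
  let ?s = "setv x_N 1 s"
  let ?c = "mul_com x_a x_N x_q ;; x_N ::= Var x_a"
  have "fst (run xs (For x_r x_rank ?c) ?s) x_N = fst s x_q ^ fst ?s x_rank"
  proof (rule For_rule[where I = "\<lambda>n s'. fst s' x_N = fst s x_q ^ n"])
    fix n s' assume "agree (For x_r x_rank ?c) ?s s'" "fst s' x_N = fst s x_q ^ n"
    moreover from this have "fst s' x_q = fst s x_q"
      using agreeD(1)[of _ ?s s' x_q] by auto
    ultimately show "fst (setv x_r (Suc n) (run xs ?c s')) x_N = fst s x_q ^ Suc n"
      by (simp add: run_mul_com)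
  qed auto
  then show ?thesis by (simp add: pow_com_def del: run.simps(7))
qed

context low_rank_vest_input
begin

lemma dot_cong:
  assumes "\<And>j. j < d \<Longrightarrow> a j < q" "\<And>j. j < d \<Longrightarrow> w j = w' j" "\<And>j. j < d \<Longrightarrow> w' j < q"
  shows "dot a w = dot a w'"
  unfolding dot_def using assms in_carrier_iff m_closed
  by (intro finsum_cong) (auto simp: simp_implies_def)

definition ready :: "state \<Rightarrow> bool" where
  "ready s \<longleftrightarrow> fst s x_q = q \<and> fst s x_zero = \<zero>\<^bsub>F\<^esub> \<and> fst s x_d = d \<and> fst s x_m = m \<and>
     fst s x_h = h \<and> fst s x_rank = rank \<and> fst s x_N = N \<and> fst s x_N1 = N + 1 \<and>
     fst s x_k = k \<and> fst s x_mul = mul_pos \<and> fst s x_v = v_pos \<and> fst s x_T = T_pos \<and>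
     fst s x_S = S_pos"

text \<open>The constants are numbered up to 15 and the working variables from 16 on, so a
  comparison of numbers settles the frame condition.\<close>

lemma ready_agree:
  assumes "agree c s s'" "ready s" "\<forall>x\<in>mods c. 15 < x"
  shows "ready s'"
proof -
  have "fst s' x = fst s x" if "x \<le> 15" for x
    using that assms(3) by (intro agreeD(1)[OF assms(1)]) (auto dest!: bspec)
  then show ?thesis using assms(2) by (simp add: ready_def)
qed

lemma ready_run: "ready s \<Longrightarrow> \<forall>x\<in>mods c. 15 < x \<Longrightarrow> ready (run xs c s)"
  using ready_agree[OF agree_run] .

lemma q_pos: "0 < q"
  using zero_less by simp

lemma run_dot_com:
  assumes "ready s" and w: "\<And>j. j < d \<Longrightarrow> snd s 2 j < q"
    and a: "\<And>j. j < d \<Longrightarrow> rd xs (fst s x_o + j) = a j" "\<And>j. j < d \<Longrightarrow> a j < q"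
  shows "fst (run xs dot_com s) x_acc = dot a (snd s 2)"
proof -
  let ?s = "setv x_acc \<zero>\<^bsub>F\<^esub> s"
  define c where "c = x_a ::= Inp (Plus (Var x_o) (Vr x_j)) ;;
       mul_com x_b x_a x_q ;;
       x_a ::= Inp (Plus (Plus (Get 2 (Var x_j)) (Vr x_b)) (Vr x_mul)) ;;
       mul_com x_b x_a x_q ;;
       x_acc ::= Inp (Plus (Plus (Var x_b) (Vr x_acc)) (Cn 3))"
  have s: "ready ?s" using assms(1) by (simp add: ready_def)
  let ?f = "\<lambda>j. a j \<otimes>\<^bsub>F\<^esub> snd s 2 j"
  let ?I = "\<lambda>n s'. fst s' x_acc = (\<Oplus>\<^bsub>F\<^esub>j\<in>{..<n}. ?f j)"
  have "?I (fst ?s x_d) (run xs (For x_j x_d c) ?s)"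
  proof (rule For_rule[where I = ?I])
    fix n s' assume n: "n < fst ?s x_d" "fst s' x_j = n" and ag: "agree (For x_j x_d c) ?s s'"
      and I: "?I n s'"
    have r: "ready s'" using s by (rule ready_agree[OF ag]) (auto simp: c_def)
    have fr: "fst s' x_o = fst s x_o" "snd s' = snd s"
      using agreeD[OF ag] by (auto simp: c_def)
    have nd: "n < d" using n(1) s by (simp add: ready_def)
    have f: "a j \<in> carrier F" "snd s 2 j \<in> carrier F" if "j < d" for j
      using that w a(2) by (auto simp: in_carrier_iff)
    have fc: "?f j \<in> carrier F" if "j < d" for j using f[OF that] by simp
    have acc: "(\<Oplus>\<^bsub>F\<^esub>j\<in>{..<n}. ?f j) \<in> carrier F"
      using fc nd by (intro finsum_closed) auto
    \<comment> \<open>The new summand stands on the left, as in the look-up, where the product is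
      the first operand.\<close>
    have "(\<Oplus>\<^bsub>F\<^esub>j\<in>{..<Suc n}. ?f j) = ?f n \<oplus>\<^bsub>F\<^esub> (\<Oplus>\<^bsub>F\<^esub>j\<in>{..<n}. ?f j)"
      unfolding lessThan_Suc using fc nd by (intro finsum_insert) auto
    moreover have "rd xs (?f n * q + (\<Oplus>\<^bsub>F\<^esub>j\<in>{..<n}. ?f j) + 3) =
        ?f n \<oplus>\<^bsub>F\<^esub> (\<Oplus>\<^bsub>F\<^esub>j\<in>{..<n}. ?f j)"
      using fc[OF nd] acc by (intro rd_add) (simp_all add: in_carrier_iff)
    moreover have "rd xs (snd s 2 n + a n * q + mul_pos) = ?f n"
      using w a(2) nd by (intro rd_mul) auto
    ultimately show "?I (Suc n) (setv x_j (Suc n) (run xs c s'))"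
      using r fr n(2) I a(1)[OF nd] by (simp add: c_def run_mul_com ready_def)
  qed (auto simp: c_def)
  then show ?thesis using assms(1)
    by (simp add: dot_com_def c_def dot_def ready_def del: run.simps(7))
qed

lemma run_succ_com:
  assumes "ready s" and w: "\<And>j. j < d \<Longrightarrow> snd s 2 j = dec x j" and i: "fst s x_i = i" "i < m"
  shows "fst (run xs succ_com s) x_y = succ_state i x"
proof -
  let ?s = "setv x_y 0 s"
  define c' where "c' = mul_com x_a x_y x_q ;; x_y ::= Plus (Var x_a) (Vr x_acc)"
  define body where "body = T_row_com ;; dot_com ;; c'"
  have s: "ready ?s" using assms(1) by (simp add: ready_def)
  let ?f = "\<lambda>r. dot (\<lambda>j. vest_T V ! i $$ (r, j)) (dec x)"
  let ?I = "\<lambda>n s'. fst s' x_y = horner q ?f n"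
  have "?I (fst ?s x_rank) (run xs (For x_r x_rank body) ?s)"
  proof (rule For_rule[where I = ?I])
    fix n s' assume n: "n < fst ?s x_rank" "fst s' x_r = n"
      and ag: "agree (For x_r x_rank body) ?s s'" and I: "?I n s'"
    have r: "ready s'" using s by (rule ready_agree[OF ag]) (auto simp: body_def T_row_com_def c'_def)
    have fr: "fst s' x_i = i" "snd s' = snd s"
      using agreeD[OF ag] i(1) by (auto simp: body_def T_row_com_def c'_def)
    have nd: "n < d" using n(1) s by (simp add: ready_def rank_def)
    let ?s1 = "run xs T_row_com s'"
    have 1: "ready ?s1" using r by (rule ready_run) (auto simp: T_row_com_def)
    have o: "fst ?s1 x_o = (i * d + n) * d + T_pos"
      using r fr n(2) by (simp add: T_row_com_def run_mul_com ready_def)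
    have fr1: "snd ?s1 = snd s" "fst ?s1 x_y = horner q ?f n"
      using fr I by (simp_all add: T_row_com_def)
    have "fst (run xs dot_com ?s1) x_acc = dot (\<lambda>j. vest_T V ! i $$ (n, j)) (snd ?s1 2)"
      using 1
    proof (rule run_dot_com)
      show "snd ?s1 2 j < q" if "j < d" for j using fr1 w dec_less that by simp
      show "rd xs (fst ?s1 x_o + j) = vest_T V ! i $$ (n, j)" if "j < d" for j
        unfolding o by (rule rd_T) (use i nd that in auto)
      show "vest_T V ! i $$ (n, j) < q" if "j < d" for j
        using i nd that by (intro T_entry)
    qed
    also have "\<dots> = ?f n"
      unfolding fr1(1) using T_entry[OF i(2) nd] w dec_less by (intro dot_cong)
    finally have acc: "fst (run xs dot_com ?s1) x_acc = ?f n" .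
    have "ready (run xs dot_com ?s1)" using 1 by (rule ready_run) auto
    then have "?I (Suc n) (run xs c' (run xs dot_com ?s1))"
      using acc fr1 by (simp add: c'_def run_mul_com ready_def run_mods)
    then show "?I (Suc n) (setv x_r (Suc n) (run xs body s'))"
      by (simp add: body_def)
  qed (auto simp: body_def T_row_com_def c'_def)
  then show ?thesis using assms(1)
    by (simp add: succ_com_def body_def c'_def succ_state_def ready_def del: run.simps(7))
qed

lemma run_divmod_com:
  assumes "ready s" "fst s x_y < N"
  shows "fst (run xs divmod_com s) x_y = fst s x_y mod q"
    and "fst (run xs divmod_com s) x_quo = fst s x_y div q"
proof -
  let ?s = "setv x_quo 0 s"
  define c where "c = If (Minus (Plus (Var x_y) (Cn 1)) (Vr x_q))
         (x_y ::= Minus (Var x_y) (Vr x_q) ;; x_quo ::= Plus (Var x_quo) (Cn 1)) Skip"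
  have s: "ready ?s" using assms(1) by (simp add: ready_def)
  \<comment> \<open>Either the division is already finished or each of the \<open>n\<close> rounds
    has subtracted \<open>q\<close>.\<close>
  let ?I = "\<lambda>n s'. fst s' x_y + fst s' x_quo * q = fst s x_y \<and>
    (fst s' x_y < q \<or> fst s' x_quo = n)"
  have "?I (fst ?s x_N) (run xs (For x_j x_N c) ?s)"
  proof (rule For_rule[where I = ?I])
    fix n s' assume ag: "agree (For x_j x_N c) ?s s'" and I: "?I n s'"
    have "ready s'" using s by (rule ready_agree[OF ag]) (auto simp: c_def)
    then show "?I (Suc n) (setv x_j (Suc n) (run xs c s'))"
      using I by (auto simp: c_def ready_def)
  qed (auto simp: c_def)
  then have I: "?I N (run xs divmod_com s)" using assms(1)
    by (simp add: divmod_com_def c_def ready_def del: run.simps(7))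
  \<comment> \<open>Otherwise all \<open>N\<close> rounds would have subtracted
    \<open>q \<ge> 1\<close>, which is impossible for an initial value below
    \<open>N\<close>.\<close>
  have "fst (run xs divmod_com s) x_y < q"
  proof (rule ccontr)
    assume "\<not> fst (run xs divmod_com s) x_y < q"
    then have "N * q \<le> fst s x_y" using I by (metis le_add2)
    moreover have "N \<le> N * q" using q_pos by simp
    ultimately show False using assms(2) by linarith
  qed
  moreover have "fst s x_y = fst (run xs divmod_com s) x_y + fst (run xs divmod_com s) x_quo * q"
    using I by simp
  ultimately show "fst (run xs divmod_com s) x_y = fst s x_y mod q"
    and "fst (run xs divmod_com s) x_quo = fst s x_y div q"
    using q_pos by simp_all
qed

lemma run_dec_com:
  assumes "ready s" "j < d"
  shows "snd (run xs dec_com s) 2 j = dec (fst s x_x) j"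
proof (cases "fst s x_x < N")
  case False
  let ?c = "Put 2 x_j (Inp (Plus (Var x_v) (Vr x_j)))"
  let ?I = "\<lambda>n s'. \<forall>j<n. snd s' 2 j = rd xs (v_pos + j)"
  have "?I (fst s x_d) (run xs (For x_j x_d ?c) s)"
  proof (rule For_rule[where I = ?I])
    fix n s' assume "fst s' x_j = n" and ag: "agree (For x_j x_d ?c) s s'" and I: "?I n s'"
    moreover have "ready s'" using assms(1) by (rule ready_agree[OF ag]) auto
    ultimately show "?I (Suc n) (setv x_j (Suc n) (run xs ?c s'))"
      by (auto simp: ready_def less_Suc_eq)
  qed auto
  then show ?thesis
    using assms False rd_v by (simp add: dec_com_def dec_def ready_def del: run.simps(7))
next
  case True
  let ?x = "fst s x_x"
  let ?c = "Put 2 x_j (Var x_zero)"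
  let ?s1 = "run xs (For x_j x_d ?c) s"
  let ?I = "\<lambda>n s'. \<forall>j<n. snd s' 2 j = \<zero>\<^bsub>F\<^esub>"
  have "?I (fst s x_d) ?s1"
  proof (rule For_rule[where I = ?I])
    fix n s' assume "fst s' x_j = n" and ag: "agree (For x_j x_d ?c) s s'" and I: "?I n s'"
    moreover have "ready s'" using assms(1) by (rule ready_agree[OF ag]) auto
    ultimately show "?I (Suc n) (setv x_j (Suc n) (run xs ?c s'))"
      by (auto simp: ready_def less_Suc_eq)
  qed auto
  then have z: "snd ?s1 2 j = \<zero>\<^bsub>F\<^esub>" if "j < d" for j
    using that assms(1) by (simp add: ready_def)
  let ?s = "setv x_y ?x ?s1"
  have "ready ?s1" using assms(1) by (rule ready_run) auto
  then have s: "ready ?s" by (simp add: ready_def)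
  define c where "c = x_a ::= Minus (Minus (Var x_rank) (Cn 1)) (Vr x_r) ;;
         Put 2 x_a (Var x_y) ;; x_y ::= Var x_quo"
  define body where "body = divmod_com ;; c"
  \<comment> \<open>After \<open>n\<close> rounds the last \<open>n\<close> of the first
    \<open>rank\<close> coordinates hold their digits, and all others are still zero.\<close>
  let ?J = "\<lambda>n s'. fst s' x_y = ?x div q ^ n \<and>
    (\<forall>j<d. snd s' 2 j =
      (if j < rank \<and> rank - n \<le> j then ?x div q ^ (rank - 1 - j) mod q else \<zero>\<^bsub>F\<^esub>))"
  have "?J (fst ?s x_rank) (run xs (For x_r x_rank body) ?s)"
  proof (rule For_rule[where I = ?J])
    show "?J 0 (setv x_r 0 ?s)" using z by simp
    fix n s' assume n: "n < fst ?s x_rank" "fst s' x_r = n"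
      and ag: "agree (For x_r x_rank body) ?s s'" and J: "?J n s'"
    have r: "ready s'" using s by (rule ready_agree[OF ag]) (auto simp: body_def c_def)
    have nr: "n < rank" using n(1) s by (simp add: ready_def)
    have "fst s' x_y < N" using J True by (metis div_le_dividend le_less_trans)
    note dm = run_divmod_com[OF r this]
    let ?s2 = "run xs divmod_com s'"
    have r2: "ready ?s2" using r by (rule ready_run) auto
    have fr: "fst ?s2 x_r = n" "snd ?s2 = snd s'" using n(2) by (auto simp: run_mods run_mods_arr)
    have iff: "j < rank \<and> rank - Suc n \<le> j \<longleftrightarrow> j = rank - 1 - n \<or> (j < rank \<and> rank - n \<le> j)" for j
      using nr by linarith
    have "?x div q ^ n mod q = ?x div q ^ (rank - 1 - (rank - 1 - n)) mod q"
      using nr by simp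
    then show "?J (Suc n) (setv x_r (Suc n) (run xs body s'))"
      using J dm fr r2 unfolding iff
      by (auto simp: body_def c_def ready_def div_mult2_eq mult.commute[of q])
  qed (auto simp: body_def c_def divmod_com_def)
  then have "?J rank (run xs dec_com s)" using assms(1) True
    by (simp add: dec_com_def body_def c_def ready_def run_mods del: run.simps(7))
  then show ?thesis using True assms(2) by (simp add: dec_def)
qed

lemma run_test_com:
  assumes "ready s" and w: "\<And>j. j < d \<Longrightarrow> snd s 2 j = dec x j"
  shows "fst (run xs test_com s) x_flag = table 0 x"
proof -
  let ?s = "setv x_flag 1 s"
  define c where "c = If (Minus (Var x_acc) (Vr x_zero)) (x_flag ::= Num 0) Skip ;;
       If (Minus (Var x_zero) (Vr x_acc)) (x_flag ::= Num 0) Skip"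
  define body where "body = S_row_com ;; dot_com ;; c"
  have s: "ready ?s" using assms(1) by (simp add: ready_def)
  let ?f = "\<lambda>r. dot (\<lambda>j. vest_S V $$ (r, j)) (dec x)"
  let ?I = "\<lambda>n s'. fst s' x_flag = (if \<forall>r<n. ?f r = \<zero>\<^bsub>F\<^esub> then 1 else 0)"
  have "?I (fst ?s x_h) (run xs (For x_r x_h body) ?s)"
  proof (rule For_rule[where I = ?I])
    fix n s' assume n: "n < fst ?s x_h" "fst s' x_r = n"
      and ag: "agree (For x_r x_h body) ?s s'" and I: "?I n s'"
    have r: "ready s'" using s by (rule ready_agree[OF ag]) (auto simp: body_def S_row_com_def c_def)
    have fr: "snd s' = snd s"
      using agreeD[OF ag] by (auto simp: body_def S_row_com_def c_def)
    have nh: "n < h" using n(1) s by (simp add: ready_def)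
    let ?s1 = "run xs S_row_com s'"
    have 1: "ready ?s1" using r by (rule ready_run) (auto simp: S_row_com_def)
    have o: "fst ?s1 x_o = n * d + S_pos"
      using r n(2) by (simp add: S_row_com_def run_mul_com ready_def)
    have fr1: "snd ?s1 = snd s" "fst ?s1 x_flag = fst s' x_flag"
      using fr by (simp_all add: S_row_com_def)
    have "fst (run xs dot_com ?s1) x_acc = dot (\<lambda>j. vest_S V $$ (n, j)) (snd ?s1 2)"
      using 1
    proof (rule run_dot_com)
      show "snd ?s1 2 j < q" if "j < d" for j using fr1 w dec_less that by simp
      show "rd xs (fst ?s1 x_o + j) = vest_S V $$ (n, j)" if "j < d" for j
        unfolding o by (rule rd_S) (use nh that in auto)
      show "vest_S V $$ (n, j) < q" if "j < d" for j
        using nh that by (intro S_entry)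
    qed
    also have "\<dots> = ?f n"
      unfolding fr1(1) using S_entry[OF nh] w dec_less by (intro dot_cong)
    finally have acc: "fst (run xs dot_com ?s1) x_acc = ?f n" .
    have "ready (run xs dot_com ?s1)" using 1 by (rule ready_run) auto
    then have "?I (Suc n) (run xs c (run xs dot_com ?s1))"
      using acc fr1 I by (auto simp: c_def ready_def run_mods less_Suc_eq)
    then show "?I (Suc n) (setv x_r (Suc n) (run xs body s'))"
      by (simp add: body_def)
  qed (auto simp: body_def S_row_com_def c_def)
  then show ?thesis using assms(1)
    by (simp add: test_com_def body_def c_def ready_def del: run.simps(7))
qed

lemma run_sum_com:
  assumes "ready s" and w: "\<And>j. j < d \<Longrightarrow> snd s 2 j = dec x j"
    and t: "\<And>y. y \<le> N \<Longrightarrow> snd s 0 y = table t y"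
  shows "fst (run xs sum_com s) x_sum = table (Suc t) x"
proof -
  let ?s = "setv x_sum 0 s"
  define c where "c = succ_com ;; x_sum ::= Plus (Get 0 (Var x_y)) (Vr x_sum)"
  have s: "ready ?s" using assms(1) by (simp add: ready_def)
  let ?I = "\<lambda>n s'. fst s' x_sum = (\<Sum>i<n. table t (succ_state i x))"
  have "?I (fst ?s x_m) (run xs (For x_i x_m c) ?s)"
  proof (rule For_rule[where I = ?I])
    fix n s' assume n: "n < fst ?s x_m" "fst s' x_i = n"
      and ag: "agree (For x_i x_m c) ?s s'" and I: "?I n s'"
    have r: "ready s'" using s by (rule ready_agree[OF ag]) (auto simp: c_def)
    have fr: "snd s' = snd s" using agreeD[OF ag] by (auto simp: c_def)
    have nm: "n < m" using n(1) s by (simp add: ready_def)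
    have "fst (run xs succ_com s') x_y = succ_state n x"
      using r w n(2) nm fr by (intro run_succ_com) auto
    moreover have "succ_state n x \<le> N" using succ_state_less[OF nm] by (rule less_imp_le)
    ultimately show "?I (Suc n) (setv x_i (Suc n) (run xs c s'))"
      using I t fr by (simp add: c_def run_mods run_mods_arr)
  qed (auto simp: c_def)
  then show ?thesis using assms(1)
    by (simp add: sum_com_def c_def ready_def del: run.simps(7))
qed

lemma run_init_com:
  assumes "ready s" "x \<le> N"
  shows "snd (run xs init_com s) 0 x = table 0 x"
proof -
  define c where "c = dec_com ;; test_com ;; Put 0 x_x (Var x_flag)"
  let ?I = "\<lambda>n s'. \<forall>x<n. snd s' 0 x = table 0 x"
  have "?I (fst s x_N1) (run xs (For x_x x_N1 c) s)"
  proof (rule For_rule[where I = ?I])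
    fix n s' assume n: "fst s' x_x = n" and ag: "agree (For x_x x_N1 c) s s'" and I: "?I n s'"
    have r: "ready s'" using assms(1) by (rule ready_agree[OF ag]) (auto simp: c_def)
    let ?s1 = "run xs dec_com s'"
    have "ready ?s1" using r by (rule ready_run) auto
    moreover have "snd ?s1 2 j = dec n j" if "j < d" for j
      using run_dec_com[OF r that] n by simp
    ultimately have "fst (run xs test_com ?s1) x_flag = table 0 n"
      by (rule run_test_com)
    then show "?I (Suc n) (setv x_x (Suc n) (run xs c s'))"
      using I n by (auto simp: c_def run_mods run_mods_arr less_Suc_eq simp del: table.simps)
  qed (auto simp: c_def)
  then show ?thesis using assms by (simp add: init_com_def c_def ready_def del: run.simps(7) table.simps)
qed

lemma run_step_com:
  assumes "ready s" "\<And>y. y \<le> N \<Longrightarrow> snd s 0 y = table t y" "x \<le> N"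
  shows "snd (run xs step_com s) 0 x = table (Suc t) x"
proof -
  define c where "c = dec_com ;; sum_com ;; Put 1 x_x (Var x_sum)"
  let ?c' = "Put 0 x_x (Get 1 (Var x_x))"
  let ?s1 = "run xs (For x_x x_N1 c) s"
  let ?I = "\<lambda>n s'. \<forall>x<n. snd s' 1 x = table (Suc t) x"
  have "?I (fst s x_N1) ?s1"
  proof (rule For_rule[where I = ?I])
    fix n s' assume n: "fst s' x_x = n" and ag: "agree (For x_x x_N1 c) s s'" and I: "?I n s'"
    have r: "ready s'" using assms(1) by (rule ready_agree[OF ag]) (auto simp: c_def)
    have fr: "snd s' 0 = snd s 0" using agreeD[OF ag] by (auto simp: c_def)
    let ?s1 = "run xs dec_com s'"
    have "ready ?s1" using r by (rule ready_run) auto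
    moreover have "snd ?s1 2 j = dec n j" if "j < d" for j
      using run_dec_com[OF r that] n by simp
    ultimately have "fst (run xs sum_com ?s1) x_sum = table (Suc t) n"
      by (rule run_sum_com) (use assms(2) fr in \<open>simp_all add: run_mods_arr\<close>)
    then show "?I (Suc n) (setv x_x (Suc n) (run xs c s'))"
      using I n by (auto simp: c_def run_mods run_mods_arr less_Suc_eq simp del: table.simps)
  qed (auto simp: c_def)
  then have B: "snd ?s1 1 x = table (Suc t) x" if "x \<le> N" for x
    using assms(1) that by (simp add: ready_def del: table.simps)
  have r1: "ready ?s1" using assms(1) by (rule ready_run) (auto simp: c_def)
  let ?J = "\<lambda>n s'. \<forall>x<n. snd s' 0 x = snd ?s1 1 x"
  have "?J (fst ?s1 x_N1) (run xs (For x_x x_N1 ?c') ?s1)"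
  proof (rule For_rule[where I = ?J])
    fix n s' assume "fst s' x_x = n" and "agree (For x_x x_N1 ?c') ?s1 s'" and "?J n s'"
    moreover from this have "snd s' 1 = snd ?s1 1" using agreeD by auto
    ultimately show "?J (Suc n) (setv x_x (Suc n) (run xs ?c' s'))"
      by (auto simp: less_Suc_eq)
  qed auto
  then show ?thesis
    using r1 B assms(3) by (simp add: step_com_def c_def ready_def del: run.simps(7) table.simps)
qed

lemma run_main_com:
  assumes "ready s"
  shows "snd (run xs main_com s) 0 N = vest_M F V k" and "fst (run xs main_com s) x_N = N"
proof -
  let ?s = "run xs init_com s"
  have s: "ready ?s" using assms by (rule ready_run) (auto simp: init_com_def)
  let ?I = "\<lambda>n s'. \<forall>x\<le>N. snd s' 0 x = table n x"
  have "?I (fst ?s x_k) (run xs (For x_t x_k step_com) ?s)"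
  proof (rule For_rule[where I = ?I])
    show "?I 0 (setv x_t 0 ?s)" using run_init_com[OF assms] by simp
    fix n s' assume "agree (For x_t x_k step_com) ?s s'" and "?I n s'"
    moreover from this have "ready s'"
      using s by (intro ready_agree[OF _ s]) (auto simp: step_com_def)
    ultimately show "?I (Suc n) (setv x_t (Suc n) (run xs step_com s'))"
      using run_step_com by simp
  qed (auto simp: step_com_def)
  moreover have "fst ?s x_k = k" using s by (simp add: ready_def)
  ultimately have "table k N = snd (run xs main_com s) 0 N" by (simp add: main_com_def del: run.simps(7))
  then show "snd (run xs main_com s) 0 N = vest_M F V k" by (simp add: vest_M_table)
  show "fst (run xs main_com s) x_N = N"
    using assms by (subst run_mods) (auto simp: main_com_def init_com_def step_com_def ready_def)
qed

lemma run_setup1_com: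
  "fst (run xs setup1_com s) x_q = q" "fst (run xs setup1_com s) x_zero = \<zero>\<^bsub>F\<^esub>"
  using rd_q rd_zero by (simp_all add: setup1_com_def)

lemma run_setup2_com:
  fixes s defines "s' \<equiv> run xs setup2_com s"
  assumes "fst s x_q = q" "fst s x_zero = \<zero>\<^bsub>F\<^esub>"
  shows "fst s' x_q = q" "fst s' x_zero = \<zero>\<^bsub>F\<^esub>" "fst s' x_d = d" "fst s' x_m = m"
    "fst s' x_h = h" "fst s' x_rank = rank" "fst s' x_mul = mul_pos" "fst s' x_v = v_pos"
    "fst s' x_T = T_pos"
  using assms rd_head
  by (auto simp: s'_def setup2_com_def run_mul_com head_pos_def mul_pos_def v_pos_def T_pos_def
      rank_def min_def)

lemma run_setup3_com:
  fixes s defines "s' \<equiv> run xs setup3_com s"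
  assumes "fst s x_q = q" "fst s x_zero = \<zero>\<^bsub>F\<^esub>" "fst s x_d = d" "fst s x_m = m"
    "fst s x_h = h" "fst s x_rank = rank" "fst s x_mul = mul_pos" "fst s x_v = v_pos"
    "fst s x_T = T_pos"
  shows "ready s'"
  using assms unary_at_k
  by (simp add: s'_def setup3_com_def run_mul_com run_pow_com ready_def run_mods S_pos_def
      k_pos_def N_def)

section \<open>The running time\<close>

definition bound :: nat where "bound = q ^ p * input_size xs"

lemma input_size_ge: "8 + 2 * (q * q) + d + m * (d * d) + h * d + k \<le> input_size xs"
  using length_le_input_size[of xs] by (simp add: length_xs)

lemma input_size_le_bound: "input_size xs \<le> bound"
  using q_pos by (simp add: bound_def)

text \<open>Only \<open>N + 1\<close> needs the factor \<open>q ^ p\<close>. The other quantities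
  are at most the length of the input; for \<open>m\<close> and \<open>h\<close> this uses
  \<open>0 < d\<close>, by which every matrix has entries.\<close>

lemma le_bound:
  "q \<le> bound" "d \<le> bound" "m \<le> bound" "h \<le> bound" "k \<le> bound" "rank \<le> bound"
  "N + 1 \<le> bound" "1 \<le> bound" "unary_at xs i \<le> bound"
proof -
  have "0 < d" using vest_inst by (simp add: vest_instance_def)
  then have "m \<le> m * (d * d)" "h \<le> h * d" "q \<le> q * q" using q_pos by simp_all
  moreover have "rank \<le> d" by (simp add: rank_def)
  ultimately show "q \<le> bound" "d \<le> bound" "m \<le> bound" "h \<le> bound" "k \<le> bound" "rank \<le> bound"
    "1 \<le> bound"
    using input_size_ge input_size_le_bound by linarith+
  show "unary_at xs i \<le> bound"
    using unary_at_le[of xs i] length_le_input_size[of xs] input_size_le_bound by linarith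
  have "N \<le> q ^ p" unfolding N_def using q_pos by (intro power_increasing) (auto simp: rank_def)
  moreover have "1 \<le> q ^ p" using q_pos by simp
  \<comment> \<open>The factor 2 fits into the input size, which is at least 8.\<close>
  ultimately have "N + 1 \<le> q ^ p * 2" by linarith
  also have "\<dots> \<le> bound" unfolding bound_def using input_size_ge by (intro mult_le_mono2) simp
  finally show "N + 1 \<le> bound" .
qed

text \<open>\<open>cost_bound\<close> is applied to the phases because \<open>vest_com\<close> as a
  whole assigns its loop bounds. With the common exponent \<open>D\<close> the bounds of the phases
  can be added.\<close>

lemma cost_phase:
  assumes "wf_com c" "loop_bounds c \<inter> mods c = {}" "\<And>x. x \<in> loop_bounds c \<Longrightarrow> fst s x \<le> bound"
    and "loop_depth c \<le> D"
  shows "cost xs c s \<le> cost_factor c * bound ^ D"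
proof -
  have "cost xs c s \<le> cost_factor c * bound ^ loop_depth c"
    using assms le_bound by (intro cost_bound) auto
  also have "\<dots> \<le> cost_factor c * bound ^ D"
    using assms(4) le_bound(8) by (intro mult_le_mono2 power_increasing) auto
  finally show ?thesis .
qed

lemmas all_com_defs = setup1_com_def setup2_com_def setup3_com_def main_com_def init_com_def
  step_com_def sum_com_def test_com_def dec_com_def divmod_com_def succ_com_def dot_com_def
  S_row_com_def T_row_com_def pow_com_def mul_com_def

lemma vest_com_correct:
  "eval xs (run xs vest_com init_state) (Get 0 (Var x_N)) = vest_M F V k"
  "cost xs vest_com init_state \<le> cost_factor vest_com * bound ^ loop_depth vest_com"
proof -
  let ?s1 = "run xs setup1_com init_state"
  let ?s2 = "run xs setup2_com ?s1"
  let ?s3 = "run xs setup3_com ?s2"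
  let ?D = "loop_depth vest_com"
  note s1 = run_setup1_com[of init_state]
  note s2 = run_setup2_com[OF s1]
  have s3: "ready ?s3" by (rule run_setup3_com[OF s2])
  show "eval xs (run xs vest_com init_state) (Get 0 (Var x_N)) = vest_M F V k"
    using run_main_com[OF s3] by (simp add: vest_com_def)
  have wf: "wf_com setup1_com" "wf_com setup2_com" "wf_com setup3_com" "wf_com main_com"
    using wf_vest_com by (simp_all add: vest_com_def)
  have D: "loop_depth setup1_com \<le> ?D" "loop_depth setup2_com \<le> ?D" "loop_depth setup3_com \<le> ?D"
    "loop_depth main_com \<le> ?D"
    by (simp_all add: vest_com_def)
  have "cost xs setup1_com init_state \<le> cost_factor setup1_com * bound ^ ?D"
    using wf(1) _ _ D(1) by (rule cost_phase) (simp_all add: setup1_com_def)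
  moreover have "cost xs setup2_com ?s1 \<le> cost_factor setup2_com * bound ^ ?D"
    using wf(2) _ _ D(2)
    by (rule cost_phase) (use s1 le_bound in \<open>auto simp: setup2_com_def mul_com_def simp del: run.simps\<close>)
  moreover have "cost xs setup3_com ?s2 \<le> cost_factor setup3_com * bound ^ ?D"
    using wf(3) _ _ D(3)
    by (rule cost_phase) (use s2 le_bound in \<open>auto simp: setup3_com_def pow_com_def mul_com_def\<close>)
  moreover have "cost xs main_com ?s3 \<le> cost_factor main_com * bound ^ ?D"
    using wf(4) _ _ D(4)
  proof (rule cost_phase)
    have lb: "loop_bounds main_com = {x_N1, x_k, x_d, x_rank, x_N, x_h, x_m, x_q}"
      by (auto simp: all_com_defs)
    show "loop_bounds main_com \<inter> mods main_com = {}"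
      unfolding lb by (auto simp: main_com_def init_com_def step_com_def)
    show "fst ?s3 x \<le> bound" if "x \<in> loop_bounds main_com" for x
      using that s3 le_bound unfolding lb ready_def by auto
  qed
  ultimately show "cost xs vest_com init_state \<le> cost_factor vest_com * bound ^ ?D"
    by (simp add: vest_com_def distrib_right)
qed

end

text \<open>This is the parameter-dependent factor of the running time, with the nesting depth as
  \<open>n\<close>. \<open>pow_com\<close> is reused with the exponent \<open>b * n\<close> in
  \<open>x_rank\<close>; any running time is allowed, so the exact cost serves as witness.\<close>

lemma computable2_power: "computable2 (\<lambda>a b. a ^ (b * n))"
proof -
  let ?c = "x_q ::= Inp (Num 0) ;; x_a ::= Inp (Num 1) ;; x_m ::= Num n ;;
    mul_com x_rank x_a x_m ;; pow_com"
  have "wf_com ?c" by (simp add: pow_com_def)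
  moreover have "eval [a, b] (run [a, b] ?c init_state) (Var x_N) = a ^ (b * n)" for a b
    by (simp add: run_pow_com run_mul_com rd_def)
  ultimately have "ram_computes_within (compile ?c (Var x_N)) [a, b] (a ^ (b * n))
      (cost [a, b] ?c init_state + length (expr_code (Var x_N)))" for a b
    by (intro ram_computes_compile) auto
  then show ?thesis unfolding computable2_def by blast
qed

theorem theorem4:
  shows "fpt
    {(F, p, V, k).
       finite_field_presentation F \<and> vest_instance F V \<and> rows_zero_from F p V}
    encode_input
    (\<lambda>(F, p, V, k). card (carrier F))
    (\<lambda>(F, p, V, k). p)
    (\<lambda>(F, p, V, k). vest_M F V k)"
proof -
  \<comment> \<open>The answer is the table entry at index \<open>N\<close>, the number that stands
    for v.\<close>
  define e where "e = Get 0 (Var x_N)"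
  define D where "D = loop_depth vest_com"
  define K where "K = cost_factor vest_com + length (expr_code e)"
  have "ram_computes_within (compile vest_com e) (encode_input (F, p, V, k)) (vest_M F V k)
      (card (carrier F) ^ (p * D) * input_size (encode_input (F, p, V, k)) ^ (D + K))"
    if "finite_field_presentation F" "vest_instance F V" "rows_zero_from F p V" for F p V k
  proof -
    define xs where "xs = encode_input (F, p, V, k)"
    interpret low_rank_vest_input F p V k xs
      using that xs_def by unfold_locales auto
    let ?n = "input_size xs"
    have n: "2 \<le> ?n" using input_size_ge by linarith
    \<comment> \<open>The constant factor is moved into the polynomial part: as the input size is at
      least 2, its \<open>K\<close>-th power is at least \<open>K\<close>.\<close>
    have "K \<le> 2 ^ K" by (rule less_imp_le, rule less_exp)
    also have "\<dots> \<le> ?n ^ K" using n by (rule power_mono) simp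
    finally have K: "K \<le> ?n ^ K" .
    have "length (expr_code e) \<le> length (expr_code e) * bound ^ D"
      using le_bound(8) by simp
    then have "cost xs vest_com init_state + length (expr_code e) \<le>
        K * bound ^ D"
      unfolding K_def distrib_right D_def using vest_com_correct(2) by (rule add_mono[rotated])
    also have "\<dots> \<le> ?n ^ K * bound ^ D" using K by (rule mult_le_mono1)
    also have "\<dots> = card (carrier F) ^ (p * D) * ?n ^ (D + K)"
      by (simp add: bound_def power_mult_distrib power_add mult_ac flip: power_mult)
    finally show ?thesis
      unfolding xs_def[symmetric] using vest_com_correct(1) wf_vest_com
      by (intro ram_computes_compile) (simp_all add: e_def)
  qed
  then show ?thesis
    unfolding fpt_def using computable2_power[of D] by fast
qed

end
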